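(* Let $\rho_0>0$ and $L_0\ge1$, and let $(X,d)$ be a compact, $(L_0,\rho_0)$-quasi-selfsimilar metric space. Then the following are equivalent. (i) $(X,d)$ is biLipschitz equivalent to a snowflake. (ii) $(X,d)$ does not contain non-trivial (i.e. non-constant) rectifiable curves. (iii) $\mathbf{M}_1(X)=\{0\}$.
   Context: **Quasi-selfsimilarity.** For $\rho_0>0$ and $L_0\ge1$, $(X,d)$ is $(L_0,\rho_0)$-quasi-selfsimilar if for every $x\in X$ and $0<\rho\le\rho_0$, with $\overline{B}(x,\rho)=\{y\in X: d(x,y)\le\rho\}$, there is an $L_0$-biLipschitz map (not necessarily surjective) $\Phi\colon(\overline{B}(x,\rho),\frac{\rho_0}{\rho}d)\to(X,d)$. **Snowflakes.** A map $f\colon(X,d)\to(Y,d')$ is $C$-biLipschitz, $C\ge1$, if $C^{-1}d(x,x')\le d'(f(x),f(x'))\le C\,d(x,x')$ for all $x,x'\in X$, and biLipschitz if it is $C$-biLipschitz for some $C$. Two metric spaces are biLipschitz equivalent if there is a surjective biLipschitz map from one onto the other. A metric space $(X,d)$ is a snowflake if there are $\alpha\in(0,1)$ and a metric space $(Y,\rho)$ with $(X,d)=(Y,\rho^\alpha)$. **Rectifiable curves.** A curve is a continuous map $\gamma\colon[0,1]\to X$; its length is $\ell(\gamma)=\sup\sum_{i=0}^{N-1}d(\gamma(t_i),\gamma(t_{i+1}))$ over all partitions $0=t_0<\dots<t_N=1$, $N\in\mathbb{N}$. It is rectifiable if $\ell(\gamma)<\infty$. **Metric currents.** Let $\mathrm{Lip}(X)$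 be the real-valued Lipschitz functions, $\mathrm{Lip}_b(X)$ the bounded ones, and $\mathrm{LIP}(\pi)$ the Lipschitz constant of $\pi$. A metric $1$-current is a multilinear (i.e. bilinear) functional $T\colon \mathrm{Lip}_b(X)\times\mathrm{Lip}(X)\to\mathbb{R}$ such that: (Locality) $T(f,\pi)=0$ if $\pi$ is constant on a neighbourhood of $\{f\ne0\}$; (Continuity) if $f\in\mathrm{Lip}_b(X)$, $\pi_n,\pi\in\mathrm{Lip}(X)$, $\sup_n\mathrm{LIP}(\pi_n)<\infty$ and $\pi_n\to\pi$ pointwise, then $T(f,\pi_n)\to T(f,\pi)$; (Finite mass) there is a finite nonnegative Borel measure $\mu$ on $X$ with $|T(f,\pi)|\le\mathrm{LIP}(\pi)\int|f|\,d\mu$ for all $(f,\pi)$. $\mathbf{M}_1(X)$ denotes the space of metric $1$-currents on $X$. *)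

theory Defs
  imports "HOL-Analysis.Analysis"
begin

text \<open>
  Metric spaces are values of the library type \<open>'a metric\<close>, so that several metrics can live
  on one carrier set. Functions on a space \<open>X\<close> are total HOL functions of which only the values
  on \<open>mspace X\<close> matter.
\<close>

section \<open>BiLipschitz maps, snowflakes, quasi-selfsimilarity\<close>

definition biLipschitz_map :: "real \<Rightarrow> 'a metric \<Rightarrow> 'b metric \<Rightarrow> ('a \<Rightarrow> 'b) \<Rightarrow> bool" where
  "biLipschitz_map C X Y f \<longleftrightarrow>
     1 \<le> C \<and> f \<in> mspace X \<rightarrow> mspace Y \<and>
     (\<forall>x\<in>mspace X. \<forall>x'\<in>mspace X.
        inverse C * mdist X x x' \<le> mdist Y (f x) (f x') \<and>
        mdist Y (f x) (f x') \<le> C * mdist X x x')"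

definition biLipschitz_equivalent :: "'a metric \<Rightarrow> 'b metric \<Rightarrow> bool" where
  "biLipschitz_equivalent X Y \<longleftrightarrow>
     (\<exists>C f. biLipschitz_map C X Y f \<and> f ` mspace X = mspace Y)"

definition snowflake :: "'a metric \<Rightarrow> bool" where
  "snowflake X \<longleftrightarrow>
     (\<exists>\<alpha>\<in>{0<..<1}. \<exists>Y::'a metric.
        mspace X = mspace Y \<and>
        (\<forall>x\<in>mspace X. \<forall>x'\<in>mspace X. mdist X x x' = mdist Y x x' powr \<alpha>))"

text \<open>
  The snowflake is sought on the type of points of \<open>X\<close>, since HOL cannot quantify over types
  inside a formula. This loses nothing: see \<open>biLipschitz_equivalent_to_snowflakeI\<close> below.
\<close>

definition biLipschitz_equivalent_to_snowflake :: "'a metric \<Rightarrow> bool" where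
  "biLipschitz_equivalent_to_snowflake X \<longleftrightarrow>
     (\<exists>S::'a metric. snowflake S \<and> biLipschitz_equivalent X S)"

lemma pullback_metric:
  assumes "inj_on f M" "f ` M \<subseteq> mspace Y"
  shows "mspace (metric (M, \<lambda>x x'. mdist Y (f x) (f x'))) = M"
    and "mdist (metric (M, \<lambda>x x'. mdist Y (f x) (f x'))) = (\<lambda>x x'. mdist Y (f x) (f x'))"
proof -
  interpret Metric_space M "\<lambda>x x'. mdist Y (f x) (f x')"
  proof
    fix x y assume "x \<in> M" "y \<in> M"
    with assms show "mdist Y (f x) (f y) = 0 \<longleftrightarrow> x = y"
      by (metis image_subset_iff inj_on_eq_iff mdist_zero)
  next
    fix x y z assume "x \<in> M" "y \<in> M" "z \<in> M"
    with assms show "mdist Y (f x) (f z) \<le> mdist Y (f x) (f y) + mdist Y (f y) (f z)"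
      by (meson image_subset_iff mdist_triangle)
  qed (simp_all add: mdist_commute)
  show "mspace (metric (M, \<lambda>x x'. mdist Y (f x) (f x'))) = M"
    "mdist (metric (M, \<lambda>x x'. mdist Y (f x) (f x'))) = (\<lambda>x x'. mdist Y (f x) (f x'))"
    by simp_all
qed

lemma biLipschitz_map_inj_on:
  assumes "biLipschitz_map C X Y f"
  shows "inj_on f (mspace X)"
proof (rule inj_onI)
  fix x y assume x: "x \<in> mspace X" and y: "y \<in> mspace X" and eq: "f x = f y"
  have C: "1 \<le> C" and "f x \<in> mspace Y" "f y \<in> mspace Y"
    and le: "inverse C * mdist X x y \<le> mdist Y (f x) (f y)"
    using assms x y by (auto simp: biLipschitz_map_def)
  then have "mdist Y (f x) (f y) = 0"
    using eq by simp
  with le C have "mdist X x y \<le> 0"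
    by (simp add: field_simps)
  then have "mdist X x y = 0"
    by (simp add: order_antisym)
  with x y show "x = y"
    by simp
qed

lemma biLipschitz_equivalent_to_snowflakeI:
  fixes X :: "'a metric" and S :: "'b metric"
  assumes "snowflake S" "biLipschitz_equivalent X S"
  shows "biLipschitz_equivalent_to_snowflake X"
proof -
  obtain C f where f: "biLipschitz_map C X S f" and im: "f ` mspace X = mspace S"
    using assms(2) by (auto simp: biLipschitz_equivalent_def)
  obtain \<alpha> and Y :: "'b metric" where \<alpha>: "\<alpha> \<in> {0<..<1}" and Y: "mspace S = mspace Y"
    "\<forall>x\<in>mspace S. \<forall>x'\<in>mspace S. mdist S x x' = mdist Y x x' powr \<alpha>"
    using assms(1) unfolding snowflake_def by blast
  have inj: "inj_on f (mspace X)"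
    using f by (rule biLipschitz_map_inj_on)
  define S' where "S' = metric (mspace X, \<lambda>x x'. mdist S (f x) (f x'))"
  define Y' where "Y' = metric (mspace X, \<lambda>x x'. mdist Y (f x) (f x'))"
  have S': "mspace S' = mspace X" "mdist S' = (\<lambda>x x'. mdist S (f x) (f x'))"
    unfolding S'_def using pullback_metric[OF inj] im by auto
  have Y': "mspace Y' = mspace X" "mdist Y' = (\<lambda>x x'. mdist Y (f x) (f x'))"
    unfolding Y'_def using pullback_metric[OF inj] im Y(1) by auto
  have "snowflake S'"
    unfolding snowflake_def
  proof (intro bexI[of _ \<alpha>] exI[of _ Y'] conjI ballI)
    fix x x' assume "x \<in> mspace S'" "x' \<in> mspace S'"
    then have "f x \<in> mspace S" "f x' \<in> mspace S"
      using im S' by auto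
    then show "mdist S' x x' = mdist Y' x x' powr \<alpha>"
      using Y S' Y' by simp
  qed (use \<alpha> S' Y' in simp_all)
  moreover have "biLipschitz_map C X S' (\<lambda>x. x)"
    using f S' by (auto simp: biLipschitz_map_def)
  then have "biLipschitz_equivalent X S'"
    unfolding biLipschitz_equivalent_def using S'(1) by (intro exI[of _ C] exI[of _ "\<lambda>x. x"]) auto
  ultimately show ?thesis
    unfolding biLipschitz_equivalent_to_snowflake_def by blast
qed

definition scaled_metric :: "real \<Rightarrow> 'a metric \<Rightarrow> 'a metric" where
  "scaled_metric c X = metric (mspace X, \<lambda>x y. c * mdist X x y)"

lemma
  assumes "0 < c"
  shows mspace_scaled_metric: "mspace (scaled_metric c X) = mspace X"
    and mdist_scaled_metric: "mdist (scaled_metric c X) = (\<lambda>x y. c * mdist X x y)"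
proof -
  interpret Metric_space "mspace X" "\<lambda>x y. c * mdist X x y"
  proof
    fix x y z assume "x \<in> mspace X" "y \<in> mspace X" "z \<in> mspace X"
    then show "c * mdist X x z \<le> c * mdist X x y + c * mdist X y z"
      using assms mdist_triangle[of x X y z] by (simp flip: distrib_left)
  qed (use assms in \<open>auto simp: mdist_commute\<close>)
  show "mspace (scaled_metric c X) = mspace X"
    "mdist (scaled_metric c X) = (\<lambda>x y. c * mdist X x y)"
    by (simp_all add: scaled_metric_def)
qed

definition quasi_selfsimilar :: "real \<Rightarrow> real \<Rightarrow> 'a metric \<Rightarrow> bool" where
  "quasi_selfsimilar L\<^sub>0 \<rho>\<^sub>0 X \<longleftrightarrow>
     (\<forall>x\<in>mspace X. \<forall>\<rho>. 0 < \<rho> \<and> \<rho> \<le> \<rho>\<^sub>0 \<longrightarrow>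
        (\<exists>\<Phi>. biLipschitz_map L\<^sub>0
               (scaled_metric (\<rho>\<^sub>0 / \<rho>) (submetric X (mcball_of X x \<rho>))) X \<Phi>))"

section \<open>Rectifiable curves\<close>

definition curve_in :: "'a metric \<Rightarrow> (real \<Rightarrow> 'a) \<Rightarrow> bool" where
  "curve_in X \<gamma> \<longleftrightarrow> continuous_map (top_of_set {0..1}) (mtopology_of X) \<gamma>"

definition curve_length :: "'a metric \<Rightarrow> (real \<Rightarrow> 'a) \<Rightarrow> ennreal" where
  "curve_length X \<gamma> =
     (SUP (N, t) \<in> {(N, t). t 0 = 0 \<and> t N = 1 \<and> strict_mono_on {..N::nat} t}.
        ennreal (\<Sum>i<N. mdist X (\<gamma> (t i)) (\<gamma> (t (Suc i)))))"

definition rectifiable_curve :: "'a metric \<Rightarrow> (real \<Rightarrow> 'a) \<Rightarrow> bool" where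
  "rectifiable_curve X \<gamma> \<longleftrightarrow> curve_in X \<gamma> \<and> curve_length X \<gamma> < \<infinity>"

section \<open>Metric 1-currents\<close>

definition Lip :: "'a metric \<Rightarrow> ('a \<Rightarrow> real) set" where
  "Lip X = {f. Lipschitz_continuous_map X euclidean_metric f}"

definition Lip_b :: "'a metric \<Rightarrow> ('a \<Rightarrow> real) set" where
  "Lip_b X = {f \<in> Lip X. bounded (f ` mspace X)}"

definition LIP :: "'a metric \<Rightarrow> ('a \<Rightarrow> real) \<Rightarrow> real" where
  "LIP X \<pi> = Inf {L. 0 \<le> L \<and> (\<forall>x\<in>mspace X. \<forall>y\<in>mspace X. \<bar>\<pi> x - \<pi> y\<bar> \<le> L * mdist X x y)}"

definition borel_sets_of :: "'a metric \<Rightarrow> 'a set set" where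
  "borel_sets_of X = sigma_sets (mspace X) {U. openin (mtopology_of X) U}"

definition current_bilinear :: "'a metric \<Rightarrow> (('a \<Rightarrow> real) \<Rightarrow> ('a \<Rightarrow> real) \<Rightarrow> real) \<Rightarrow> bool" where
  "current_bilinear X T \<longleftrightarrow>
     (\<forall>f\<in>Lip_b X. \<forall>g\<in>Lip_b X. \<forall>\<pi>\<in>Lip X. \<forall>a b.
        T (\<lambda>x. a * f x + b * g x) \<pi> = a * T f \<pi> + b * T g \<pi>) \<and>
     (\<forall>f\<in>Lip_b X. \<forall>\<pi>\<in>Lip X. \<forall>\<sigma>\<in>Lip X. \<forall>a b.
        T f (\<lambda>x. a * \<pi> x + b * \<sigma> x) = a * T f \<pi> + b * T f \<sigma>)"

definition current_local :: "'a metric \<Rightarrow> (('a \<Rightarrow> real) \<Rightarrow> ('a \<Rightarrow> real) \<Rightarrow> real) \<Rightarrow> bool" where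
  "current_local X T \<longleftrightarrow>
     (\<forall>f\<in>Lip_b X. \<forall>\<pi>\<in>Lip X. \<forall>U.
        openin (mtopology_of X) U \<and> {x \<in> mspace X. f x \<noteq> 0} \<subseteq> U \<and> \<pi> constant_on U \<longrightarrow>
        T f \<pi> = 0)"

definition current_continuous :: "'a metric \<Rightarrow> (('a \<Rightarrow> real) \<Rightarrow> ('a \<Rightarrow> real) \<Rightarrow> real) \<Rightarrow> bool" where
  "current_continuous X T \<longleftrightarrow>
     (\<forall>f\<in>Lip_b X. \<forall>\<pi>\<in>Lip X. \<forall>\<pi>s :: nat \<Rightarrow> 'a \<Rightarrow> real.
        (\<forall>n. \<pi>s n \<in> Lip X) \<and> bdd_above (range (\<lambda>n. LIP X (\<pi>s n))) \<and>
        (\<forall>x\<in>mspace X. (\<lambda>n. \<pi>s n x) \<longlonglongrightarrow> \<pi> x) \<longrightarrow>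
        (\<lambda>n. T f (\<pi>s n)) \<longlonglongrightarrow> T f \<pi>)"

definition current_finite_mass :: "'a metric \<Rightarrow> (('a \<Rightarrow> real) \<Rightarrow> ('a \<Rightarrow> real) \<Rightarrow> real) \<Rightarrow> bool" where
  "current_finite_mass X T \<longleftrightarrow>
     (\<exists>\<mu>. space \<mu> = mspace X \<and> sets \<mu> = borel_sets_of X \<and> finite_measure \<mu> \<and>
        (\<forall>f\<in>Lip_b X. \<forall>\<pi>\<in>Lip X. \<bar>T f \<pi>\<bar> \<le> LIP X \<pi> * (\<integral>x. \<bar>f x\<bar> \<partial>\<mu>)))"

text \<open>
  On \<open>Lip_b X \<times> Lip X\<close>, bilinearity and finite mass force \<open>T f \<pi>\<close> to depend only on the
  restrictions of \<open>f\<close> and \<open>\<pi>\<close> to \<open>mspace X\<close>. Off that domain \<open>T\<close> is set to \<open>0\<close>,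
  so that each current is represented exactly once and the zero current is \<open>\<lambda>f \<pi>. 0\<close>.
\<close>

definition metric_1_currents ::
    "'a metric \<Rightarrow> (('a \<Rightarrow> real) \<Rightarrow> ('a \<Rightarrow> real) \<Rightarrow> real) set" (\<open>\<^bold>M\<^sub>1\<close>) where
  "metric_1_currents X =
     {T. (\<forall>f \<pi>. \<not> (f \<in> Lip_b X \<and> \<pi> \<in> Lip X) \<longrightarrow> T f \<pi> = 0) \<and>
         current_bilinear X T \<and> current_local X T \<and>
         current_continuous X T \<and> current_finite_mass X T}"

end

theory Submission
  imports Defs
begin

text \<open>
  The three properties are compared with a fourth one that is easier to work with: the metric
  \<open>d\<close> of \<open>X\<close> is bounded above and below by multiples of \<open>\<rho>\<^sup>\<alpha>\<close> for some metric \<open>\<rho>\<close> on the same points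
  and some \<open>0 < \<alpha> < 1\<close> (\<open>snowflake_comparable\<close>). By pulling back along a biLipschitz map this is
  the same as being biLipschitz equivalent to a snowflake. The theorem follows from a dichotomy:
  if \<open>d\<close> is comparable to such a \<open>\<rho>\<^sup>\<alpha>\<close>, then there is neither a nonconstant rectifiable
  curve nor a nonzero current; if not, then \<open>X\<close> contains a Lipschitz arc with distinct end points, and this gives both a
  rectifiable curve and a nonzero current.

  \<^bold>\<open>Snowflake.\<close> Put \<open>s = 1 / \<alpha> > 1\<close>, so that \<open>\<rho> \<le> (C d)\<^sup>s\<close>. Along a partition of a curve of finite
  \<open>d\<close>-length with mesh at most \<open>\<eta>\<close>, the \<open>\<rho>\<close>-length is at most a constant times \<open>\<eta>\<^bsup>s-1\<^esup>\<close>, hence the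
  curve is constant (\<open>rectifiable_curve_in_snowflake_constant\<close>). For the same reason a
  \<open>\<rho>\<close>-Lipschitz function \<open>g\<close> has arbitrarily small \<open>d\<close>-Lipschitz constants on small balls. Locality
  and finite mass then force \<open>T(f, g) = 0\<close> for each current \<open>T\<close>, after \<open>f\<close> has been cut into pieces
  supported in small balls (\<open>little_Lipschitz_imp_zero\<close>). Every \<open>d\<close>-Lipschitz function is a
  pointwise limit of \<open>\<rho>\<close>-Lipschitz functions with bounded \<open>d\<close>-Lipschitz constants
  (\<open>snowflake_approximation\<close>), so the continuity of \<open>T\<close> gives \<open>T = 0\<close>.

  \<^bold>\<open>No snowflake.\<close> Suppose that for some \<open>0 < \<epsilon> < 1\<close> every chain of points with steps at most
  \<open>\<epsilon> d(x, y)\<close> from \<open>x\<close> to \<open>y\<close> has length at least \<open>2 d(x, y)\<close> (\<open>fine_chains_long\<close>). Applied at every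
  scale, this gives \<open>\<Sum> d(x\<^sub>i, x\<^sub>i\<^sub>+\<^sub>1)\<^sup>s \<ge> c d(x, y)\<^sup>s\<close> for all chains, for some \<open>s > 1\<close> and \<open>c > 0\<close>
  (\<open>fine_chains_long_imp_power_sum_bound\<close>), and the infimum of these sums is a metric \<open>\<rho>\<close>
  comparable to \<open>d\<^sup>s\<close>. Hence, if \<open>X\<close> is not a snowflake, there are arbitrarily fine chains of length
  less than twice the distance of their end points. Quasi-selfsimilarity blows them up to
  a definite size, and compactness extracts a Lipschitz arc
  (\<open>no_Lipschitz_arc_imp_fine_chains_long\<close>). Its current is \<open>(f, \<pi>) \<mapsto> \<integral> f \<circ> g d(\<pi> \<circ> g)\<close>, a limit of
  dyadic Riemann--Stieltjes sums, which takes the value \<open>d(g(0), g(1)) \<noteq> 0\<close> on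
  \<open>f = 1\<close> and \<open>\<pi> = d(g(0), _)\<close>.
\<close>

section \<open>Metrics comparable to a power of a metric\<close>

definition snowflake_comparable :: "'a metric \<Rightarrow> 'a metric \<Rightarrow> real \<Rightarrow> real \<Rightarrow> bool" where
  "snowflake_comparable X Y \<alpha> C \<longleftrightarrow>
     mspace Y = mspace X \<and> 0 < \<alpha> \<and> \<alpha> < 1 \<and> 1 \<le> C \<and>
     (\<forall>x\<in>mspace X. \<forall>y\<in>mspace X.
        mdist Y x y powr \<alpha> \<le> C * mdist X x y \<and> mdist X x y \<le> C * mdist Y x y powr \<alpha>)"

lemma mdist_self [simp]: "x \<in> mspace X \<Longrightarrow> mdist X x x = 0"
  by simp

text \<open>
  An increasing modulus \<open>t \<mapsto> t * k t\<close> whose slope \<open>k\<close> decreases is subadditive, because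
  \<open>(a + b) k(a + b) = a k(a + b) + b k(a + b)\<close>. Composed with a metric it therefore satisfies the
  triangle inequality. This serves both for \<open>t\<^sup>\<alpha>\<close> and for the truncation \<open>min (n t) (t\<^sup>\<alpha>)\<close>.
\<close>

lemma decreasing_slope_triangle:
  fixes k :: "real \<Rightarrow> real"
  assumes dec: "\<And>s t. 0 < s \<Longrightarrow> s \<le> t \<Longrightarrow> k t \<le> k s"
    and inc: "\<And>s t. 0 \<le> s \<Longrightarrow> s \<le> t \<Longrightarrow> s * k s \<le> t * k t"
    and "0 \<le> a" "0 \<le> b" "0 \<le> c" "c \<le> a + b"
  shows "c * k c \<le> a * k a + b * k b"
proof -
  have "c * k c \<le> (a + b) * k (a + b)"
    using assms by blast
  moreover have "a * k (a + b) \<le> a * k a" "b * k (a + b) \<le> b * k b"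
    using dec[of a "a + b"] dec[of b "a + b"] \<open>0 \<le> a\<close> \<open>0 \<le> b\<close>
    by (metis add.commute le_add_same_cancel1 less_eq_real_def mult_left_mono mult_zero_left)+
  ultimately show ?thesis
    by (simp add: distrib_right)
qed

lemma powr_triangle:
  fixes a b c \<alpha> :: real
  assumes "0 < \<alpha>" "\<alpha> < 1" "0 \<le> a" "0 \<le> b" "0 \<le> c" "c \<le> a + b"
  shows "c powr \<alpha> \<le> a powr \<alpha> + b powr \<alpha>"
proof -
  have *: "t powr \<alpha> = t * t powr (\<alpha> - 1)" if "0 \<le> t" for t :: real
    using that by (simp add: powr_diff)
  have "c * c powr (\<alpha> - 1) \<le> a * a powr (\<alpha> - 1) + b * b powr (\<alpha> - 1)"
  proof (rule decreasing_slope_triangle)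
    fix s t :: real
    show "t powr (\<alpha> - 1) \<le> s powr (\<alpha> - 1)" if "0 < s" "s \<le> t"
      using that assms by (intro powr_mono2') auto
    show "s * s powr (\<alpha> - 1) \<le> t * t powr (\<alpha> - 1)" if "0 \<le> s" "s \<le> t"
      using that assms by (simp add: powr_mono2 flip: *)
  qed (use assms in auto)
  with assms show ?thesis
    by (simp add: *)
qed

lemma mdist_chain_le:
  assumes "a \<le> b" and "\<And>i. a \<le> i \<Longrightarrow> i \<le> b \<Longrightarrow> p i \<in> mspace X"
  shows "mdist X (p a) (p b) \<le> (\<Sum>i\<in>{a..<b}. mdist X (p i) (p (Suc i)))"
  using assms
proof (induction b rule: dec_induct)
  case base
  then show ?case
    by simp
next
  case (step b)
  then show ?case
    using mdist_triangle[of "p a" X "p b" "p (Suc b)"] by simp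
qed

text \<open>
  Pulling the snowflake back along the biLipschitz map moves everything to the points of \<open>X\<close>;
  conversely \<open>\<rho>\<^sup>\<alpha>\<close> is itself a metric, and the identity is biLipschitz onto it.
\<close>

lemma biLipschitz_equivalent_to_snowflake_iff:
  "biLipschitz_equivalent_to_snowflake X \<longleftrightarrow> (\<exists>Y \<alpha> C. snowflake_comparable X Y \<alpha> C)"
proof
  assume "biLipschitz_equivalent_to_snowflake X"
  then obtain S :: "'a metric" and C f \<alpha> and Y :: "'a metric"
    where f: "biLipschitz_map C X S f" and im: "f ` mspace X = mspace S"
      and \<alpha>: "0 < \<alpha>" "\<alpha> < 1" and Y: "mspace S = mspace Y"
      and SY: "\<And>x x'. x \<in> mspace S \<Longrightarrow> x' \<in> mspace S \<Longrightarrow> mdist S x x' = mdist Y x x' powr \<alpha>"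
    unfolding biLipschitz_equivalent_to_snowflake_def biLipschitz_equivalent_def snowflake_def
    by (metis greaterThanLessThan_iff)
  define Y' where "Y' = metric (mspace X, \<lambda>x x'. mdist Y (f x) (f x'))"
  have Y': "mspace Y' = mspace X" "mdist Y' = (\<lambda>x x'. mdist Y (f x) (f x'))"
    unfolding Y'_def using pullback_metric[OF biLipschitz_map_inj_on[OF f]] im Y by auto
  have C: "1 \<le> C"
    using f by (simp add: biLipschitz_map_def)
  have "snowflake_comparable X Y' \<alpha> C"
    unfolding snowflake_comparable_def
  proof (intro conjI ballI)
    fix x y assume xy: "x \<in> mspace X" "y \<in> mspace X"
    then have eq: "mdist Y' x y powr \<alpha> = mdist S (f x) (f y)"
      using SY[of "f x" "f y"] Y'(2) by (metis im imageI)
    show "mdist Y' x y powr \<alpha> \<le> C * mdist X x y"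
      using f xy eq by (auto simp: biLipschitz_map_def)
    have "inverse C * mdist X x y \<le> mdist S (f x) (f y)"
      using f xy by (auto simp: biLipschitz_map_def)
    then show "mdist X x y \<le> C * mdist Y' x y powr \<alpha>"
      using C eq by (simp add: field_simps)
  qed (use C \<alpha> Y' in auto)
  then show "\<exists>Y \<alpha> C. snowflake_comparable X Y \<alpha> C"
    by blast
next
  assume "\<exists>Y \<alpha> C. snowflake_comparable X Y \<alpha> C"
  then obtain Y \<alpha> C where Y: "mspace Y = mspace X" and \<alpha>: "0 < \<alpha>" "\<alpha> < 1" and C: "1 \<le> C"
    and cmp: "\<And>x y. x \<in> mspace X \<Longrightarrow> y \<in> mspace X \<Longrightarrow>
      mdist Y x y powr \<alpha> \<le> C * mdist X x y \<and> mdist X x y \<le> C * mdist Y x y powr \<alpha>"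
    unfolding snowflake_comparable_def by auto
  interpret S: Metric_space "mspace X" "\<lambda>x y. mdist Y x y powr \<alpha>"
  proof
    fix x y z assume "x \<in> mspace X" "y \<in> mspace X" "z \<in> mspace X"
    then show "mdist Y x z powr \<alpha> \<le> mdist Y x y powr \<alpha> + mdist Y y z powr \<alpha>"
      using \<alpha> Y by (intro powr_triangle) (auto intro: mdist_triangle)
  qed (use Y in \<open>auto simp: mdist_commute\<close>)
  have "snowflake S.Self"
    unfolding snowflake_def using \<alpha> Y by (intro bexI[of _ \<alpha>] exI[of _ Y]) auto
  moreover have "biLipschitz_map C X S.Self (\<lambda>x. x)"
    using C cmp by (auto simp: biLipschitz_map_def field_simps)
  then have "biLipschitz_equivalent X S.Self"
    unfolding biLipschitz_equivalent_def by (intro exI[of _ C] exI[of _ "\<lambda>x. x"]) auto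
  ultimately show "biLipschitz_equivalent_to_snowflake X"
    unfolding biLipschitz_equivalent_to_snowflake_def by blast
qed

section \<open>Rectifiable curves in snowflakes\<close>

text \<open>
  A \<open>d\<close>-step of size at most \<open>\<eta>\<close> has \<open>\<rho>\<close>-size at most \<open>C\<^sup>s \<eta>\<^bsup>s-1\<^esup>\<close> times its \<open>d\<close>-size, where
  \<open>s = 1 / \<alpha> > 1\<close>. Summed over a fine partition, the \<open>\<rho>\<close>-distance between any two points of a curve
  of finite \<open>d\<close>-length tends to \<open>0\<close> with \<open>\<eta>\<close>.
\<close>

lemma rectifiable_curve_in_snowflake_constant:
  assumes cmp: "snowflake_comparable X Y \<alpha> C" and \<gamma>: "rectifiable_curve X \<gamma>"
  shows "\<gamma> constant_on {0..1}"
proof -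
  have Y: "mspace Y = mspace X" and \<alpha>: "0 < \<alpha>" "\<alpha> < 1" and C: "1 \<le> C"
    and YX: "\<And>x y. x \<in> mspace X \<Longrightarrow> y \<in> mspace X \<Longrightarrow> mdist Y x y powr \<alpha> \<le> C * mdist X x y"
    and XY: "\<And>x y. x \<in> mspace X \<Longrightarrow> y \<in> mspace X \<Longrightarrow> mdist X x y \<le> C * mdist Y x y powr \<alpha>"
    using cmp unfolding snowflake_comparable_def by auto
  define s where "s = 1 / \<alpha>"
  have s: "1 < s"
    using \<alpha> by (simp add: s_def)
  have "continuous_map (mtopology_of (submetric euclidean_metric {0..1::real})) (mtopology_of X) \<gamma>"
    using \<gamma> by (simp add: rectifiable_curve_def curve_in_def mtopology_of_submetric)
  moreover have "compact_space (mtopology_of (submetric euclidean_metric {0..1::real}))"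
    by (simp add: mtopology_of_submetric compact_space_subtopology)
  ultimately have uc: "uniformly_continuous_map (submetric euclidean_metric {0..1}) X \<gamma>"
    using continuous_imp_uniformly_continuous_map by blast
  then have \<gamma>in: "\<gamma> t \<in> mspace X" if "t \<in> {0..1}" for t
    using that by (auto simp: uniformly_continuous_map_def)
  obtain l where l: "0 \<le> l" "curve_length X \<gamma> = ennreal l"
    using \<gamma> unfolding rectifiable_curve_def
    by (metis ennreal_cases infinity_ennreal_def less_irrefl)
  have main: "mdist X (\<gamma> a) (\<gamma> b) \<le> 2 * \<eta> + C * (C powr s * \<eta> powr (s - 1) * l) powr \<alpha>"
    if ab: "a \<in> {0..1}" "b \<in> {0..1}" "a \<le> b" and \<eta>: "0 < \<eta>" for a b \<eta>
  proof -
    obtain \<delta> where \<delta>: "0 < \<delta>"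
      "\<And>u t. u \<in> {0..1} \<Longrightarrow> t \<in> {0..1} \<Longrightarrow> \<bar>t - u\<bar> < \<delta> \<Longrightarrow> mdist X (\<gamma> t) (\<gamma> u) < \<eta>"
    proof -
      have "\<exists>\<delta>>0. \<forall>u\<in>{0..1}. \<forall>t\<in>{0..1}. \<bar>t - u\<bar> < \<delta> \<longrightarrow> mdist X (\<gamma> t) (\<gamma> u) < \<eta>"
        using uc \<eta> by (simp add: uniformly_continuous_map_def dist_real_def)
      then show ?thesis
        using that by blast
    qed
    obtain m where m: "1 / real (Suc m) < \<delta>"
      using nat_approx_posE[OF \<delta>(1)] by metis
    define n where "n = Suc m"
    have n: "0 < n" "1 / real n < \<delta>"
      using m by (auto simp: n_def)
    define p where "p i = \<gamma> (real i / real n)" for i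
    have pin: "p i \<in> mspace X" if "i \<le> n" for i
      using that n unfolding p_def by (intro \<gamma>in) (auto simp: field_simps)
    have near: "mdist X (\<gamma> t) (p (nat \<lfloor>t * n\<rfloor>)) < \<eta>" and le: "nat \<lfloor>t * n\<rfloor> \<le> n"
      if t: "t \<in> {0..1}" for t
    proof -
      let ?i = "nat \<lfloor>t * n\<rfloor>"
      have i: "real ?i \<le> t * n" "t * n < real ?i + 1"
        using t by (auto simp: of_nat_nat)
      have "t * n \<le> n"
        using t n by (simp add: mult_left_le_one_le)
      with i(1) show "?i \<le> n"
        by linarith
      then show "mdist X (\<gamma> t) (p ?i) < \<eta>"
        unfolding p_def using t n i by (intro \<delta>(2)) (auto simp: field_simps abs_less_iff)
    qed
    have step: "mdist Y (p k) (p (Suc k)) \<le> C powr s * \<eta> powr (s - 1) * mdist X (p k) (p (Suc k))"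
      if "k < n" for k
    proof -
      let ?d = "mdist X (p k) (p (Suc k))"
      have "?d \<le> \<eta>"
        unfolding p_def using that n by (intro less_imp_le \<delta>(2)) (auto simp: field_simps)
      have "mdist Y (p k) (p (Suc k)) = (mdist Y (p k) (p (Suc k)) powr \<alpha>) powr s"
        using \<alpha> by (simp add: powr_powr s_def)
      also have "\<dots> \<le> (C * ?d) powr s"
        using that pin s YX by (intro powr_mono2) auto
      also have "\<dots> = C powr s * (?d powr (s - 1) * ?d)"
        using C by (simp add: powr_mult powr_diff)
      also have "\<dots> \<le> C powr s * (\<eta> powr (s - 1) * ?d)"
        using s \<open>?d \<le> \<eta>\<close> by (intro mult_left_mono mult_right_mono powr_mono2) auto
      finally show ?thesis
        by simp
    qed
    have sum_le: "(\<Sum>k<n. mdist X (p k) (p (Suc k))) \<le> l"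
    proof -
      have "ennreal (\<Sum>k<n. mdist X (p k) (p (Suc k))) \<le> curve_length X \<gamma>"
        unfolding curve_length_def p_def
        by (rule SUP_upper2[of "(n, \<lambda>i. real i / real n)"])
          (use n in \<open>auto simp: strict_mono_on_def divide_strict_right_mono\<close>)
      with l show ?thesis
        by (simp add: sum_nonneg)
    qed
    \<comment> \<open>The length is controlled along the uniform partition only, so \<open>a\<close> and \<open>b\<close> are replaced
        by the partition points below them, at a cost of \<open>\<eta>\<close> each.\<close>
    let ?i = "nat \<lfloor>a * n\<rfloor>" and ?j = "nat \<lfloor>b * n\<rfloor>"
    have "?i \<le> ?j"
      using ab n by (intro nat_mono floor_mono mult_right_mono) auto
    have "mdist Y (p ?i) (p ?j) \<le> (\<Sum>k\<in>{?i..<?j}. mdist Y (p k) (p (Suc k)))"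
      using \<open>?i \<le> ?j\<close> le[OF ab(2)] pin Y by (intro mdist_chain_le) auto
    also have "\<dots> \<le> (\<Sum>k<n. mdist Y (p k) (p (Suc k)))"
      using le[OF ab(2)] by (intro sum_mono2) auto
    also have "\<dots> \<le> (\<Sum>k<n. C powr s * \<eta> powr (s - 1) * mdist X (p k) (p (Suc k)))"
      using step by (intro sum_mono) auto
    also have "\<dots> \<le> C powr s * \<eta> powr (s - 1) * l"
      using sum_le by (simp add: mult_left_mono flip: sum_distrib_left)
    finally have "mdist Y (p ?i) (p ?j) \<le> C powr s * \<eta> powr (s - 1) * l" .
    then have "C * mdist Y (p ?i) (p ?j) powr \<alpha> \<le> C * (C powr s * \<eta> powr (s - 1) * l) powr \<alpha>"
      using \<alpha> C by (intro mult_left_mono powr_mono2) auto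
    then have "mdist X (p ?i) (p ?j) \<le> C * (C powr s * \<eta> powr (s - 1) * l) powr \<alpha>"
      using XY[OF pin pin] le ab by (meson order_trans)
    moreover have "mdist X (\<gamma> a) (\<gamma> b) \<le> mdist X (\<gamma> a) (p ?i) + mdist X (p ?i) (p ?j) + mdist X (p ?j) (\<gamma> b)"
      using mdist_triangle[of "\<gamma> a" X "p ?i" "\<gamma> b"] mdist_triangle[of "p ?i" X "p ?j" "\<gamma> b"]
        pin le ab \<gamma>in by fastforce
    ultimately show ?thesis
      using near[OF ab(1)] near[OF ab(2)] by (simp add: mdist_commute)
  qed
  have eq: "\<gamma> a = \<gamma> b" if ab: "a \<in> {0..1}" "b \<in> {0..1}" "a \<le> b" for a b
  proof -
    have "((\<lambda>\<eta>. \<eta> powr (s - 1)) \<longlongrightarrow> 0) (at_right 0)"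
      using s by (intro tendsto_zero_powrI) (auto simp: eventually_at_filter)
    then have "((\<lambda>\<eta>. C powr s * \<eta> powr (s - 1) * l) \<longlongrightarrow> 0) (at_right 0)"
      by (intro tendsto_mult_left_zero tendsto_mult_right_zero)
    then have "((\<lambda>\<eta>. (C powr s * \<eta> powr (s - 1) * l) powr \<alpha>) \<longlongrightarrow> 0) (at_right 0)"
      using \<alpha> l(1) by (intro tendsto_zero_powrI) auto
    then have "((\<lambda>\<eta>. 2 * \<eta> + C * (C powr s * \<eta> powr (s - 1) * l) powr \<alpha>) \<longlongrightarrow> 0) (at_right 0)"
      by (intro tendsto_add_zero tendsto_mult_right_zero tendsto_ident_at)
    moreover have "\<forall>\<^sub>F \<eta> in at_right 0. mdist X (\<gamma> a) (\<gamma> b) \<le> 2 * \<eta> + C * (C powr s * \<eta> powr (s - 1) * l) powr \<alpha>"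
      unfolding eventually_at_filter using main[OF ab] by (intro always_eventually) auto
    ultimately have "mdist X (\<gamma> a) (\<gamma> b) \<le> 0"
      by (intro tendsto_lowerbound) auto
    then have "mdist X (\<gamma> a) (\<gamma> b) = 0"
      by (simp add: order_antisym)
    with \<gamma>in ab show ?thesis
      by simp
  qed
  show ?thesis
    unfolding constant_on_def using eq[of 0] by (metis atLeastAtMost_iff order_refl zero_le_one)
qed

section \<open>Sums of powers along chains\<close>

text \<open>
  Greedy coarsening: from the current point, jump to the first later point of the chain at distance
  at least \<open>\<delta>\<close>. As the steps are shorter than \<open>\<delta>\<close>, the jump is at most \<open>2 \<delta>\<close>. The procedure stops once
  the end of the chain is within \<open>\<delta>\<close> of the current point.
\<close>

lemma coarse_subchain:
  assumes "a \<le> b" "0 < \<delta>"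
    and "\<And>i. a \<le> i \<Longrightarrow> i \<le> b \<Longrightarrow> p i \<in> mspace X"
    and "\<And>i. a \<le> i \<Longrightarrow> i < b \<Longrightarrow> mdist X (p i) (p (Suc i)) < \<delta>"
  shows "\<exists>m q. q 0 = a \<and> q m \<le> b \<and> mdist X (p (q m)) (p b) < \<delta> \<and>
     (\<forall>j<m. q j < q (Suc j) \<and> \<delta> \<le> mdist X (p (q j)) (p (q (Suc j))) \<and>
              mdist X (p (q j)) (p (q (Suc j))) \<le> 2 * \<delta>)"
  using assms
proof (induction "b - a" arbitrary: a rule: less_induct)
  case less
  show ?case
  proof (cases "mdist X (p a) (p b) < \<delta>")
    case True
    with less.prems show ?thesis
      by (intro exI[of _ 0] exI[of _ "\<lambda>_. a"]) auto
  next
    case False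
    define c where "c = (LEAST i. a \<le> i \<and> \<delta> \<le> mdist X (p a) (p i))"
    have c: "a \<le> c" "\<delta> \<le> mdist X (p a) (p c)" "c \<le> b"
      using LeastI[of "\<lambda>i. a \<le> i \<and> \<delta> \<le> mdist X (p a) (p i)" b]
        Least_le[of "\<lambda>i. a \<le> i \<and> \<delta> \<le> mdist X (p a) (p i)" b] False less.prems(1)
      unfolding c_def by auto
    have "a \<noteq> c"
      using c(2) less.prems(1,2) less.prems(3)[of a] by auto
    with c have "a < c"
      by simp
    then obtain k where k: "c = Suc k" "a \<le> k"
      by (metis less_imp_Suc_add le_add1)
    have "mdist X (p a) (p k) < \<delta>"
      using not_less_Least[of k "\<lambda>i. a \<le> i \<and> \<delta> \<le> mdist X (p a) (p i)"] k
      unfolding c_def by auto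
    moreover have "mdist X (p k) (p c) < \<delta>"
      using less.prems(4)[of k] k c by simp
    moreover have "mdist X (p a) (p c) \<le> mdist X (p a) (p k) + mdist X (p k) (p c)"
      using k c by (intro mdist_triangle less.prems) auto
    ultimately have ac: "mdist X (p a) (p c) \<le> 2 * \<delta>"
      by simp
    obtain m q where q: "q 0 = c" "q m \<le> b" "mdist X (p (q m)) (p b) < \<delta>"
      "\<forall>j<m. q j < q (Suc j) \<and> \<delta> \<le> mdist X (p (q j)) (p (q (Suc j))) \<and>
              mdist X (p (q j)) (p (q (Suc j))) \<le> 2 * \<delta>"
    proof -
      have "\<exists>m q. q 0 = c \<and> q m \<le> b \<and> mdist X (p (q m)) (p b) < \<delta> \<and>
        (\<forall>j<m. q j < q (Suc j) \<and> \<delta> \<le> mdist X (p (q j)) (p (q (Suc j))) \<and>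
                 mdist X (p (q j)) (p (q (Suc j))) \<le> 2 * \<delta>)"
        using \<open>a < c\<close> c less.prems by (intro less.hyps) auto
      then show ?thesis
        using that by blast
    qed
    show ?thesis
      by (rule exI[of _ "Suc m"], rule exI[of _ "case_nat a q"])
        (use q c ac \<open>a < c\<close> in \<open>auto simp: less_Suc_eq_0_disj\<close>)
  qed
qed

lemma sum_le_sum_blocks:
  fixes f :: "nat \<Rightarrow> real"
  assumes "\<And>j. j < m \<Longrightarrow> q j < q (Suc j)" and "\<And>i. 0 \<le> f i" and "q m \<le> b"
  shows "(\<Sum>j<m. \<Sum>i\<in>{q j..<q (Suc j)}. f i) \<le> (\<Sum>i\<in>{q 0..<b}. f i)"
proof -
  have "q 0 \<le> q k \<and> (\<Sum>j<k. \<Sum>i\<in>{q j..<q (Suc j)}. f i) = (\<Sum>i\<in>{q 0..<q k}. f i)" if "k \<le> m" for k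
    using that
  proof (induction k)
    case (Suc k)
    then have "q 0 \<le> q k" "q k \<le> q (Suc k)"
      using assms(1)[of k] by auto
    with Suc show ?case
      using sum.atLeastLessThan_concat[of "q 0" "q k" "q (Suc k)" f] by auto
  qed simp
  from this[of m] have "(\<Sum>j<m. \<Sum>i\<in>{q j..<q (Suc j)}. f i) = (\<Sum>i\<in>{q 0..<q m}. f i)"
    by simp
  also have "\<dots> \<le> (\<Sum>i\<in>{q 0..<b}. f i)"
    using assms by (intro sum_mono2) auto
  finally show ?thesis .
qed

text \<open>
  A quantitative, scale-invariant form of the absence of rectifiable curves. The factor \<open>2\<close> could be
  any number greater than \<open>1\<close>.
\<close>

definition fine_chains_long :: "'a metric \<Rightarrow> real \<Rightarrow> bool" where
  "fine_chains_long X \<epsilon> \<longleftrightarrow>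
     (\<forall>p N. (\<forall>i\<le>N. p i \<in> mspace X) \<and>
            (\<forall>i<N. mdist X (p i) (p (Suc i)) \<le> \<epsilon> * mdist X (p 0) (p N)) \<longrightarrow>
            2 * mdist X (p 0) (p N) \<le> (\<Sum>i<N. mdist X (p i) (p (Suc i))))"

text \<open>
  Chains are indexed by intervals \<open>{a..b}\<close> rather than \<open>{0..N}\<close> so that subchains need no reindexing
  in the induction below.
\<close>

definition power_sums_bounded_below :: "'a metric \<Rightarrow> real \<Rightarrow> real \<Rightarrow> bool" where
  "power_sums_bounded_below X s c \<longleftrightarrow>
     (\<forall>p a b. a \<le> b \<and> (\<forall>i\<in>{a..b}. p i \<in> mspace X) \<longrightarrow>
        c * mdist X (p a) (p b) powr s \<le> (\<Sum>i\<in>{a..<b}. mdist X (p i) (p (Suc i)) powr s))"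

text \<open>
  Induction on the number of steps. Let \<open>D\<close> be the distance of the end points and \<open>\<delta> = \<epsilon> / 2\<close>. If
  one step is at least \<open>\<delta> D\<close>, it alone gives the bound with \<open>c = \<delta>\<^sup>s\<close>. Otherwise the chain is coarsened
  to jumps \<open>d\<^sub>j\<close> between \<open>\<delta> D\<close> and \<open>\<epsilon> D\<close>; by hypothesis these add up to at least \<open>3/2 D\<close>, the final remainder being
  less than \<open>D / 2\<close>. The induction hypothesis for the subchains yields
  \<open>\<Sum>\<^sub>j c d\<^sub>j\<^sup>s \<ge> c (\<delta> D)\<^bsup>s-1\<^esup> \<Sum>\<^sub>j d\<^sub>j \<ge> c (3/2 \<delta>\<^bsup>s-1\<^esup>) D\<^sup>s\<close>, and \<open>s\<close> is chosen so close to \<open>1\<close> that the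
  bracket equals \<open>1\<close>.
\<close>

lemma fine_chains_long_imp_power_sum_bound:
  assumes \<epsilon>: "0 < \<epsilon>" "\<epsilon> < 1" and long: "fine_chains_long X \<epsilon>"
  obtains s c :: real where "1 < s" "0 < c"
    "power_sums_bounded_below X s c"
proof -
  define \<delta> where "\<delta> = \<epsilon> / 2"
  have \<delta>: "0 < \<delta>" "\<delta> < 1 / 2"
    using \<epsilon> by (auto simp: \<delta>_def)
  then have "ln \<delta> < 0"
    by simp
  define s where "s = 1 - ln (3 / 2) / ln \<delta>"
  have s: "1 < s"
    using \<open>ln \<delta> < 0\<close> by (simp add: s_def divide_pos_neg)
  have \<delta>s: "3 / 2 * \<delta> powr (s - 1) = 1"
    using \<delta> \<open>ln \<delta> < 0\<close> by (simp add: powr_def s_def exp_minus)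
  define c where "c = \<delta> powr s"
  have c: "0 < c"
    using \<delta> by (simp add: c_def)
  have "c * mdist X (p a) (p b) powr s \<le> (\<Sum>i\<in>{a..<b}. mdist X (p i) (p (Suc i)) powr s)"
    if "a \<le> b" "\<And>i. a \<le> i \<Longrightarrow> i \<le> b \<Longrightarrow> p i \<in> mspace X" for p a b
    using that
  proof (induction "b - a" arbitrary: a b rule: less_induct)
    case less
    define D where "D = mdist X (p a) (p b)"
    consider "D = 0" | i where "0 < D" "a \<le> i" "i < b" "\<delta> * D \<le> mdist X (p i) (p (Suc i))"
      | "0 < D" "\<And>i. a \<le> i \<Longrightarrow> i < b \<Longrightarrow> mdist X (p i) (p (Suc i)) < \<delta> * D"
      by (metis D_def mdist_nonneg less_eq_real_def not_less)
    then show ?case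
    proof cases
      case 1
      then show ?thesis
        by (simp add: D_def sum_nonneg)
    next
      case 2
      have "c * D powr s = (\<delta> * D) powr s"
        using \<delta> 2 by (simp add: c_def powr_mult)
      also have "\<dots> \<le> mdist X (p i) (p (Suc i)) powr s"
        using \<delta> 2 s by (intro powr_mono2) auto
      also have "\<dots> \<le> (\<Sum>i\<in>{a..<b}. mdist X (p i) (p (Suc i)) powr s)"
        using 2 by (intro member_le_sum) auto
      finally show ?thesis
        by (simp add: D_def)
    next
      case 3
      obtain m q where q: "q 0 = a" "q m \<le> b" "mdist X (p (q m)) (p b) < \<delta> * D"
        and step: "\<And>j. j < m \<Longrightarrow> q j < q (Suc j)"
          "\<And>j. j < m \<Longrightarrow> \<delta> * D \<le> mdist X (p (q j)) (p (q (Suc j)))"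
          "\<And>j. j < m \<Longrightarrow> mdist X (p (q j)) (p (q (Suc j))) \<le> \<epsilon> * D"
        using coarse_subchain[of a b "\<delta> * D" p X] less.prems 3 \<delta> by (auto simp: \<delta>_def)
      have q_mono: "q i \<le> q j" if "i \<le> j" "j \<le> m" for i j
        using that
      proof (induction j rule: dec_induct)
        case (step j)
        then show ?case
          using \<open>\<And>j. j < m \<Longrightarrow> q j < q (Suc j)\<close>[of j] by auto
      qed simp
      have q_in: "a \<le> q j" "q j \<le> b" if "j \<le> m" for j
        using q_mono[of 0 j] q_mono[of j m] q that by auto
      \<comment> \<open>The coarse chain must end exactly at \<open>p b\<close>, so the remainder is added as a last jump.\<close>
      define r where "r j = (if j \<le> m then p (q j) else p b)" for j
      have "2 * mdist X (r 0) (r (Suc m)) \<le> (\<Sum>i<Suc m. mdist X (r i) (r (Suc i)))"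
      proof -
        have "\<forall>i\<le>Suc m. r i \<in> mspace X"
          using less.prems q_in by (auto simp: r_def)
        moreover have "\<forall>i<Suc m. mdist X (r i) (r (Suc i)) \<le> \<epsilon> * mdist X (r 0) (r (Suc m))"
        proof (intro allI impI)
          fix i assume "i < Suc m"
          moreover have "\<delta> * D \<le> \<epsilon> * D"
            using \<epsilon> 3 by (simp add: \<delta>_def)
          ultimately show "mdist X (r i) (r (Suc i)) \<le> \<epsilon> * mdist X (r 0) (r (Suc m))"
            using step(3)[of i] q by (cases "i = m") (auto simp: r_def D_def)
        qed
        ultimately show ?thesis
          using long unfolding fine_chains_long_def by blast
      qed
      also have "(\<Sum>i<Suc m. mdist X (r i) (r (Suc i))) =
        (\<Sum>j<m. mdist X (p (q j)) (p (q (Suc j)))) + mdist X (p (q m)) (p b)"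
        by (simp add: r_def)
      finally have "2 * D \<le> (\<Sum>j<m. mdist X (p (q j)) (p (q (Suc j)))) + \<delta> * D"
        using q by (simp add: r_def D_def)
      moreover have "\<delta> * D \<le> 1 / 2 * D"
        using \<delta> 3 by (intro mult_right_mono) auto
      ultimately have len: "3 / 2 * D \<le> (\<Sum>j<m. mdist X (p (q j)) (p (q (Suc j))))"
        by simp
      have "D powr s = D * D powr (s - 1)"
        using 3 by (simp add: powr_diff)
      then have "c * D powr s = c * (3 / 2 * \<delta> powr (s - 1)) * (D * D powr (s - 1))"
        by (simp only: \<delta>s mult_1_right)
      also have "\<dots> = c * (\<delta> * D) powr (s - 1) * (3 / 2 * D)"
        using \<delta> 3 by (simp add: powr_mult)
      also have "\<dots> \<le> c * (\<delta> * D) powr (s - 1) * (\<Sum>j<m. mdist X (p (q j)) (p (q (Suc j))))"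
        using len c by (intro mult_left_mono) auto
      also have "\<dots> = (\<Sum>j<m. c * ((\<delta> * D) powr (s - 1) * mdist X (p (q j)) (p (q (Suc j)))))"
        by (simp add: sum_distrib_left mult.assoc)
      also have "\<dots> \<le> (\<Sum>j<m. \<Sum>i\<in>{q j..<q (Suc j)}. mdist X (p i) (p (Suc i)) powr s)"
      proof (rule sum_mono)
        fix j assume "j \<in> {..<m}"
        then have j: "j < m"
          by simp
        let ?d = "mdist X (p (q j)) (p (q (Suc j)))"
        \<comment> \<open>A jump is shorter than \<open>D\<close>, hence no subchain is the whole chain.\<close>
        have "?d \<noteq> D"
          using step(3)[OF j] 3 \<epsilon> by auto
        then have "q (Suc j) - q j < b - a"
          using q_in[of j] q_in[of "Suc j"] j step(1)[OF j] unfolding D_def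
          by (cases "q j = a"; cases "q (Suc j) = b") auto
        then have IH: "c * ?d powr s \<le> (\<Sum>i\<in>{q j..<q (Suc j)}. mdist X (p i) (p (Suc i)) powr s)"
          using q_in[of j] q_in[of "Suc j"] j step(1)[OF j] less.prems
          by (intro less.hyps) auto
        have "(\<delta> * D) powr (s - 1) * ?d \<le> ?d powr (s - 1) * ?d"
          using step(2)[OF j] \<delta> 3 s by (intro mult_right_mono powr_mono2) auto
        also have "\<dots> = ?d powr s"
          by (simp add: powr_diff)
        finally have "c * ((\<delta> * D) powr (s - 1) * ?d) \<le> c * ?d powr s"
          using c by (intro mult_left_mono) auto
        with IH show "c * ((\<delta> * D) powr (s - 1) * ?d) \<le>
          (\<Sum>i\<in>{q j..<q (Suc j)}. mdist X (p i) (p (Suc i)) powr s)"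
          by linarith
      qed
      also have "\<dots> \<le> (\<Sum>i\<in>{a..<b}. mdist X (p i) (p (Suc i)) powr s)"
        using sum_le_sum_blocks[of m q "\<lambda>i. mdist X (p i) (p (Suc i)) powr s" b] step q by simp
      finally show ?thesis
        by (simp add: D_def)
    qed
  qed
  then have "power_sums_bounded_below X s c"
    unfolding power_sums_bounded_below_def by auto
  with s c that show ?thesis
    by blast
qed

section \<open>The chain metric\<close>

definition chain_weights :: "'a set \<Rightarrow> ('a \<Rightarrow> 'a \<Rightarrow> real) \<Rightarrow> 'a \<Rightarrow> 'a \<Rightarrow> real set" where
  "chain_weights M w x y =
     {\<Sum>i<N. w (p i) (p (Suc i)) | p N. p 0 = x \<and> p N = y \<and> (\<forall>i\<le>N. p i \<in> M)}"

lemma chain_weights_append: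
  assumes "u \<in> chain_weights M w x y" "v \<in> chain_weights M w y z"
  shows "u + v \<in> chain_weights M w x z"
proof -
  obtain p N where p: "u = (\<Sum>i<N. w (p i) (p (Suc i)))" "p 0 = x" "p N = y" "\<forall>i\<le>N. p i \<in> M"
    using assms(1) by (auto simp: chain_weights_def)
  obtain q K where q: "v = (\<Sum>i<K. w (q i) (q (Suc i)))" "q 0 = y" "q K = z" "\<forall>i\<le>K. q i \<in> M"
    using assms(2) by (auto simp: chain_weights_def)
  define r where "r i = (if i \<le> N then p i else q (i - N))" for i
  have r: "r (N + i) = q i" for i
    using p q by (cases i) (auto simp: r_def)
  have r': "r (Suc (N + i)) = q (Suc i)" for i
    using r[of "Suc i"] by simp
  have "(\<Sum>i<N + K. w (r i) (r (Suc i))) =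
      (\<Sum>i<N. w (r i) (r (Suc i))) + (\<Sum>i<K. w (r (N + i)) (r (Suc (N + i))))"
    by (induction K) (simp_all add: add.assoc)
  also have "(\<Sum>i<N. w (r i) (r (Suc i))) = u"
    unfolding p by (intro sum.cong) (auto simp: r_def)
  also have "(\<Sum>i<K. w (r (N + i)) (r (Suc (N + i)))) = v"
    unfolding q r r' ..
  finally have "(\<Sum>i<N + K. w (r i) (r (Suc i))) = u + v" .
  moreover have "r 0 = x" "r (N + K) = z"
    using p q r[of K] by (auto simp: r_def)
  moreover have "\<forall>i\<le>N + K. r i \<in> M"
    using p q by (auto simp: r_def)
  ultimately show ?thesis
    unfolding chain_weights_def by (intro CollectI exI[of _ r] exI[of _ "N + K"]) auto
qed

lemma chain_weights_reverse:
  assumes "u \<in> chain_weights M w x y" and sym: "\<And>x y. w x y = w y x"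
  shows "u \<in> chain_weights M w y x"
proof -
  obtain p N where p: "u = (\<Sum>i<N. w (p i) (p (Suc i)))" "p 0 = x" "p N = y" "\<forall>i\<le>N. p i \<in> M"
    using assms(1) by (auto simp: chain_weights_def)
  have "u = (\<Sum>i<N. w (p (N - Suc i)) (p (Suc (N - Suc i))))"
    unfolding p(1) by (rule sum.nat_diff_reindex[symmetric])
  also have "\<dots> = (\<Sum>i<N. w (p (N - i)) (p (N - Suc i)))"
    by (intro sum.cong) (auto simp: Suc_diff_Suc sym)
  finally show ?thesis
    using p unfolding chain_weights_def
    by (intro CollectI exI[of _ "\<lambda>i. p (N - i)"] exI[of _ N]) auto
qed

text \<open>
  The infimum of the chain sums is symmetric and satisfies the triangle inequality since chains can
  be reversed and concatenated. The lower bound on the sums makes it positive for distinct points.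
\<close>

lemma chain_metric:
  assumes "0 < c" and "1 < s"
    and low: "power_sums_bounded_below X s c"
  shows "\<exists>Y :: 'a metric. mspace Y = mspace X \<and>
    (\<forall>x\<in>mspace X. \<forall>y\<in>mspace X. c * mdist X x y powr s \<le> mdist Y x y \<and>
                                mdist Y x y \<le> mdist X x y powr s)"
proof -
  define W where "W = chain_weights (mspace X) (\<lambda>x y. mdist X x y powr s)"
  \<comment> \<open>The axioms of \<open>Metric_space\<close> require nonnegativity and symmetry also off the carrier, where
      the infimum is taken over the empty set; hence the default value \<open>0\<close>.\<close>
  define \<rho> where "\<rho> x y = (if x \<in> mspace X \<and> y \<in> mspace X then Inf (W x y) else 0)" for x y
  have W_low: "c * mdist X x y powr s \<le> u" if "u \<in> W x y" for u x y
    using that low by (auto simp: W_def chain_weights_def lessThan_atLeast0 power_sums_bounded_below_def)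
  have W_step: "mdist X x y powr s \<in> W x y" if "x \<in> mspace X" "y \<in> mspace X" for x y
    using that unfolding W_def chain_weights_def
    by (intro CollectI exI[of _ "\<lambda>i. if i = 0 then x else y"] exI[of _ 1]) auto
  have W_nonneg: "0 \<le> u" if "u \<in> W x y" for u x y
    using that by (auto simp: W_def chain_weights_def intro: sum_nonneg)
  then have bdd: "bdd_below (W x y)" for x y
    by (rule bdd_belowI)
  have \<rho>_low: "c * mdist X x y powr s \<le> \<rho> x y" if "x \<in> mspace X" "y \<in> mspace X" for x y
    using that W_step[OF that] W_low by (auto simp: \<rho>_def intro!: cInf_greatest)
  have \<rho>_up: "\<rho> x y \<le> mdist X x y powr s" if "x \<in> mspace X" "y \<in> mspace X" for x y
    using that W_step[OF that] bdd by (auto simp: \<rho>_def intro!: cInf_lower)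
  have W_sym: "W x y = W y x" for x y
    unfolding W_def by (intro equalityI subsetI; erule chain_weights_reverse) (simp_all add: mdist_commute)
  interpret R: Metric_space "mspace X" \<rho>
  proof
    show "0 \<le> \<rho> x y" for x y
      using W_step[of x y] W_nonneg by (auto simp: \<rho>_def intro!: cInf_greatest)
    show "\<rho> x y = \<rho> y x" for x y
      by (simp add: \<rho>_def W_sym conj_commute)
    show "\<rho> x y = 0 \<longleftrightarrow> x = y" if "x \<in> mspace X" "y \<in> mspace X" for x y
    proof
      assume "\<rho> x y = 0"
      then have "mdist X x y powr s \<le> 0"
        using \<rho>_low[OF that] \<open>0 < c\<close> by (simp add: mult_le_0_iff)
      then show "x = y"
        using that by simp
    next
      assume "x = y"
      then show "\<rho> x y = 0"
        using \<rho>_up[OF that] \<rho>_low[OF that] that by (metis mdist_zero mult_zero_right order_antisym powr_0)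
    qed
    show "\<rho> x z \<le> \<rho> x y + \<rho> y z"
      if "x \<in> mspace X" "y \<in> mspace X" "z \<in> mspace X" for x y z
    proof -
      have "Inf (W x z) \<le> u + v" if "u \<in> W x y" "v \<in> W y z" for u v
        using that bdd chain_weights_append unfolding W_def by (intro cInf_lower) auto
      then have "Inf (W x z) - v \<le> Inf (W x y)" if "v \<in> W y z" for v
        using that W_step[OF \<open>x \<in> _\<close> \<open>y \<in> _\<close>] by (intro cInf_greatest) (auto simp: algebra_simps)
      then have "Inf (W x z) - Inf (W x y) \<le> Inf (W y z)"
        using W_step[OF \<open>y \<in> _\<close> \<open>z \<in> _\<close>] by (intro cInf_greatest) (auto simp: algebra_simps)
      with that show ?thesis
        by (simp add: \<rho>_def)
    qed
  qed
  show ?thesis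
    by (rule exI[of _ R.Self]) (use \<rho>_low \<rho>_up in auto)
qed

lemma fine_chains_long_imp_snowflake_comparable:
  assumes "0 < \<epsilon>" "\<epsilon> < 1" "fine_chains_long X \<epsilon>"
  shows "\<exists>Y \<alpha> C. snowflake_comparable X Y \<alpha> C"
proof -
  obtain s c :: real where s: "1 < s" and c: "0 < c" and low:
    "power_sums_bounded_below X s c"
    using fine_chains_long_imp_power_sum_bound[OF assms] by blast
  obtain Y :: "'a metric" where Y: "mspace Y = mspace X"
    "\<And>x y. x \<in> mspace X \<Longrightarrow> y \<in> mspace X \<Longrightarrow> c * mdist X x y powr s \<le> mdist Y x y"
    "\<And>x y. x \<in> mspace X \<Longrightarrow> y \<in> mspace X \<Longrightarrow> mdist Y x y \<le> mdist X x y powr s"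
    using chain_metric[OF c s low] by metis
  define \<alpha> where "\<alpha> = 1 / s"
  have \<alpha>: "0 < \<alpha>" "\<alpha> < 1"
    using s by (auto simp: \<alpha>_def)
  define C where "C = max 1 (c powr (- \<alpha>))"
  have "snowflake_comparable X Y \<alpha> C"
    unfolding snowflake_comparable_def
  proof (intro conjI ballI)
    fix x y assume xy: "x \<in> mspace X" "y \<in> mspace X"
    have root: "(mdist X x y powr s) powr \<alpha> = mdist X x y"
      using s by (simp add: powr_powr \<alpha>_def)
    have "mdist Y x y powr \<alpha> \<le> (mdist X x y powr s) powr \<alpha>"
      using Y(3)[OF xy] \<alpha> by (intro powr_mono2) auto
    also have "\<dots> \<le> C * mdist X x y"
      unfolding root using mult_right_mono[of 1 C "mdist X x y"] by (simp add: C_def)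
    finally show "mdist Y x y powr \<alpha> \<le> C * mdist X x y" .
    have "c powr \<alpha> * mdist X x y = (c * mdist X x y powr s) powr \<alpha>"
      using c by (simp add: powr_mult root)
    also have "\<dots> \<le> mdist Y x y powr \<alpha>"
      using Y(2)[OF xy] \<alpha> c by (intro powr_mono2) auto
    finally have "mdist X x y \<le> c powr (- \<alpha>) * mdist Y x y powr \<alpha>"
      using c by (simp add: powr_minus field_simps)
    also have "\<dots> \<le> C * mdist Y x y powr \<alpha>"
      by (intro mult_right_mono) (auto simp: C_def)
    finally show "mdist X x y \<le> C * mdist Y x y powr \<alpha>" .
  qed (use Y \<alpha> in \<open>auto simp: C_def\<close>)
  then show ?thesis
    by blast
qed

section \<open>Lipschitz arcs as limits of chains\<close>

text \<open>
  The chain is parametrised by its normalised arc length, as a step function: at time \<open>t\<close> it stands at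
  the last vertex reached by length \<open>M t\<close>. Compared with an \<open>M\<close>-Lipschitz map, at most
  one step is lost.
\<close>

lemma arclength_interpolation_of_chain:
  assumes "0 < M"
    and p: "\<And>i. i \<le> N \<Longrightarrow> p i \<in> mspace X"
    and small: "\<And>i. i < N \<Longrightarrow> mdist X (p i) (p (Suc i)) \<le> \<eta>"
    and len: "(\<Sum>i<N. mdist X (p i) (p (Suc i))) \<le> M"
    and "0 \<le> \<eta>"
  obtains g where "g \<in> {0..1} \<rightarrow> mspace X" "g 0 = p 0" "g 1 = p N"
    "\<And>t u. t \<in> {0..1} \<Longrightarrow> u \<in> {0..1} \<Longrightarrow> mdist X (g t) (g u) \<le> M * \<bar>t - u\<bar> + \<eta>"
proof -
  define \<sigma> where "\<sigma> j = (\<Sum>i<j. mdist X (p i) (p (Suc i)))" for j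
  have \<sigma>_diff: "\<sigma> j - \<sigma> i = (\<Sum>k\<in>{i..<j}. mdist X (p k) (p (Suc k)))" if "i \<le> j" for i j
    using that sum_diff_nat_ivl[of 0 i j "\<lambda>k. mdist X (p k) (p (Suc k))"]
    by (simp add: \<sigma>_def lessThan_atLeast0)
  have dist_le: "mdist X (p i) (p j) \<le> \<sigma> j - \<sigma> i" if "i \<le> j" "j \<le> N" for i j
    using mdist_chain_le[of i j p X] that p by (simp add: \<sigma>_diff)
  define J where "J t = Max {j. j \<le> N \<and> \<sigma> j \<le> M * t}" for t
  have fin: "finite {j. j \<le> N \<and> \<sigma> j \<le> M * t}" for t
    by simp
  have J: "J t \<le> N" "\<sigma> (J t) \<le> M * t" if "0 \<le> t" for t
  proof -
    have "0 \<in> {j. j \<le> N \<and> \<sigma> j \<le> M * t}"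
      using that \<open>0 < M\<close> by (simp add: \<sigma>_def)
    then have "J t \<in> {j. j \<le> N \<and> \<sigma> j \<le> M * t}"
      unfolding J_def using Max_in[OF fin] by blast
    then show "J t \<le> N" "\<sigma> (J t) \<le> M * t"
      by auto
  qed
  have J_ge: "j \<le> J t" if "j \<le> N" "\<sigma> j \<le> M * t" for j t
    unfolding J_def using that by (intro Max_ge[OF fin]) simp
  define g where "g t = (if t = 0 then p 0 else p (J t))" for t
  have "p (J 0) = p 0"
  proof -
    have "mdist X (p 0) (p (J 0)) \<le> 0"
      using dist_le[of 0 "J 0"] J[of 0] by (simp add: \<sigma>_def)
    then have "mdist X (p 0) (p (J 0)) = 0"
      by (simp add: order_antisym)
    then show ?thesis
      using p J[of 0] by (metis le0 mdist_zero order_refl)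
  qed
  then have g: "g t = p (J t)" for t
    by (simp add: g_def)
  have ordered: "mdist X (g t) (g u) \<le> M * (u - t) + \<eta>" if "0 \<le> t" "t \<le> u" for t u
  proof -
    have "M * t \<le> M * u"
      using that \<open>0 < M\<close> by simp
    then have le: "J t \<le> J u" "J u \<le> N"
      using that J[of t] J[of u] by (auto intro: J_ge)
    show ?thesis
    proof (cases "J t < N")
      case True
      then have "M * t < \<sigma> (Suc (J t))"
        using J_ge[of "Suc (J t)" t] by (meson Suc_leI Suc_n_not_le_n not_le)
      also have "\<dots> \<le> \<sigma> (J t) + \<eta>"
        using small[OF True] by (simp add: \<sigma>_def)
      finally have "M * t \<le> \<sigma> (J t) + \<eta>"
        by simp
      then show ?thesis
        using dist_le[OF le] J(2)[of u] that by (simp add: g right_diff_distrib)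
    next
      case False
      then have "J u = J t"
        using le by simp
      moreover have "mdist X (p (J t)) (p (J t)) = 0"
        using p J that by simp
      ultimately show ?thesis
        using \<open>0 \<le> \<eta>\<close> \<open>M * t \<le> M * u\<close> by (simp add: g right_diff_distrib)
    qed
  qed
  show ?thesis
  proof (rule that[of g])
    show "g \<in> {0..1} \<rightarrow> mspace X"
      using p J by (auto simp: g)
    show "g 1 = p N"
      using J(1)[of 1] J_ge[of N 1] len by (simp add: g \<sigma>_def)
    show "mdist X (g t) (g u) \<le> M * \<bar>t - u\<bar> + \<eta>" if "t \<in> {0..1}" "u \<in> {0..1}" for t u
      using ordered[of t u] ordered[of u t] that by (cases "t \<le> u") (auto simp: mdist_commute)
  qed (simp add: g_def)
qed

definition Lipschitz_arc :: "'a metric \<Rightarrow> real \<Rightarrow> (real \<Rightarrow> 'a) \<Rightarrow> bool" where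
  "Lipschitz_arc X M g \<longleftrightarrow> 0 < M \<and> g \<in> {0..1} \<rightarrow> mspace X \<and> g 0 \<noteq> g 1 \<and>
     (\<forall>t\<in>{0..1}. \<forall>u\<in>{0..1}. mdist X (g t) (g u) \<le> M * \<bar>t - u\<bar>)"

text \<open>
  The maps \<open>{0..1} \<rightarrow> X\<close> that are \<open>M\<close>-Lipschitz up to an error \<open>M / (n + 1)\<close> and whose end points are at
  distance at least \<open>c\<close> form a closed subset of the product of copies of \<open>X\<close>. The product is compact
  by Tychonoff's theorem, so these nested nonempty sets have a common element. The argument admits
  discontinuous approximations, and the step functions above are such.
\<close>

lemma Lipschitz_arc_from_chains:
  assumes cpt: "compact_space (mtopology_of X)" and "0 < M" "0 < c"
    and chains: "\<And>n::nat. \<exists>p N. (\<forall>i\<le>N. p i \<in> mspace X) \<and>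
      (\<forall>i<N. mdist X (p i) (p (Suc i)) \<le> M / Suc n) \<and>
      (\<Sum>i<N. mdist X (p i) (p (Suc i))) \<le> M \<and> c \<le> mdist X (p 0) (p N)"
  shows "\<exists>g. Lipschitz_arc X M g"
proof -
  define P where "P = product_topology (\<lambda>_. mtopology_of X) {0..1::real}"
  define F where "F n = {g \<in> topspace P. c \<le> mdist X (g 0) (g 1) \<and>
    (\<forall>t\<in>{0..1}. \<forall>u\<in>{0..1}. mdist X (g t) (g u) \<le> M * \<bar>t - u\<bar> + M / Suc n)}" for n :: nat
  have cont: "continuous_map P euclidean (\<lambda>g. mdist X (g t) (g u))" if "t \<in> {0..1}" "u \<in> {0..1}" for t u
    unfolding P_def using that by (intro continuous_map_mdist continuous_map_product_projection)
  have "closedin P (F n)" for n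
  proof -
    have "closedin P {g \<in> topspace P. mdist X (g t) (g u) \<in> {..r}}" if "t \<in> {0..1}" "u \<in> {0..1}" for t u r
      using that by (intro closedin_continuous_map_preimage[OF cont]) auto
    moreover have "closedin P {g \<in> topspace P. mdist X (g 0) (g 1) \<in> {c..}}"
      by (intro closedin_continuous_map_preimage[OF cont]) auto
    ultimately have "closedin P ({g \<in> topspace P. mdist X (g 0) (g 1) \<in> {c..}} \<inter>
      (\<Inter>(t, u)\<in>{0..1} \<times> {0..1}. {g \<in> topspace P. mdist X (g t) (g u) \<in> {..M * \<bar>t - u\<bar> + M / Suc n}}))"
      by (intro closedin_Int closedin_INT) auto
    moreover have "\<dots> = F n"
      unfolding F_def by fastforce
    ultimately show ?thesis
      by simp
  qed
  moreover have "F n \<noteq> {}" for n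
  proof -
    obtain p N where p: "\<forall>i\<le>N. p i \<in> mspace X" "\<forall>i<N. mdist X (p i) (p (Suc i)) \<le> M / Suc n"
      "(\<Sum>i<N. mdist X (p i) (p (Suc i))) \<le> M" "c \<le> mdist X (p 0) (p N)"
      using chains[of n] by blast
    obtain g where g: "g \<in> {0..1} \<rightarrow> mspace X" "g 0 = p 0" "g 1 = p N"
      "\<And>t u. t \<in> {0..1} \<Longrightarrow> u \<in> {0..1} \<Longrightarrow> mdist X (g t) (g u) \<le> M * \<bar>t - u\<bar> + M / Suc n"
      by (rule arclength_interpolation_of_chain[of M N p X "M / Suc n"]) (use p \<open>0 < M\<close> in auto)
    have "restrict g {0..1} \<in> F n"
      using g p(4) by (auto simp: F_def P_def)
    then show ?thesis
      by blast
  qed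
  moreover have "decseq F"
  proof (rule decseq_SucI)
    fix n
    have le: "M / Suc (Suc n) \<le> M / Suc n"
      using \<open>0 < M\<close> by (intro divide_left_mono) auto
    show "F (Suc n) \<le> F n"
    proof
      fix h assume h: "h \<in> F (Suc n)"
      have "mdist X (h t) (h u) \<le> M * \<bar>t - u\<bar> + M / Suc n" if "t \<in> {0..1}" "u \<in> {0..1}" for t u
      proof -
        have "mdist X (h t) (h u) \<le> M * \<bar>t - u\<bar> + M / Suc (Suc n)"
          using h that unfolding F_def by blast
        with le show ?thesis
          by linarith
      qed
      with h show "h \<in> F n"
        unfolding F_def by blast
    qed
  qed
  moreover have "compact_space P"
    unfolding P_def using cpt by (simp add: compact_space_product_topology)
  ultimately obtain g where g: "\<And>n. g \<in> F n"
    using compact_space_imp_nest[of P F] by blast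
  have "mdist X (g t) (g u) \<le> M * \<bar>t - u\<bar>" if "t \<in> {0..1}" "u \<in> {0..1}" for t u
  proof (rule LIMSEQ_le_const)
    have "(\<lambda>n. M / Suc n) \<longlonglongrightarrow> 0"
      using LIMSEQ_inverse_real_of_nat[THEN tendsto_mult_right_zero, of M] by (simp add: divide_inverse)
    from tendsto_add[OF tendsto_const this] show "(\<lambda>n. M * \<bar>t - u\<bar> + M / Suc n) \<longlonglongrightarrow> M * \<bar>t - u\<bar>"
      by simp
    show "\<exists>N. \<forall>n\<ge>N. mdist X (g t) (g u) \<le> M * \<bar>t - u\<bar> + M / real (Suc n)"
      using g that by (auto simp: F_def)
  qed
  moreover have "g \<in> {0..1} \<rightarrow> mspace X"
    using g[of 0] by (auto simp: F_def P_def)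
  moreover from this have "g 0 \<noteq> g 1"
  proof -
    assume "g \<in> {0..1} \<rightarrow> mspace X"
    then have "g 0 \<in> mspace X"
      by auto
    moreover have "c \<le> mdist X (g 0) (g 1)"
      using g[of 0] by (simp add: F_def)
    ultimately show ?thesis
      using \<open>0 < c\<close> by auto
  qed
  ultimately show ?thesis
    using \<open>0 < M\<close> unfolding Lipschitz_arc_def by blast
qed

section \<open>Blowing up short fine chains\<close>

lemma compact_mdist_bounded:
  assumes "compact_space (mtopology_of X)"
  obtains B where "0 < B" "\<And>x y. x \<in> mspace X \<Longrightarrow> y \<in> mspace X \<Longrightarrow> mdist X x y \<le> B"
proof -
  interpret Metric_space "mspace X" "mdist X"
    by simp
  have "mbounded (mspace X)"
    using assms by (intro compactin_imp_mbounded) (simp add: mtopology_of_def compact_space_def)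
  with that show ?thesis
    unfolding mbounded_alt_pos by blast
qed

text \<open>
  If \<open>fine_chains_long\<close> fails for each \<open>\<epsilon> = 1 / (n + 2)\<close>, it yields a chain of length less than \<open>2 D\<close>, with
  end points at distance \<open>D\<close> and steps at most \<open>\<epsilon> D\<close>. When \<open>2 D \<le> \<rho>\<close>, the chain lies in the ball of radius
  \<open>2 D\<close> about its first point, and quasi-selfsimilarity enlarges this ball to radius about \<open>\<rho>\<close>. The
  enlarged chains have bounded length, end points at distance at least \<open>\<rho> / (2 L)\<close> and steps
  tending to \<open>0\<close>. When \<open>2 D > \<rho>\<close>, the chain has these properties already.
\<close>

lemma no_Lipschitz_arc_imp_fine_chains_long:
  assumes "0 < \<rho>" "1 \<le> L" and cpt: "compact_space (mtopology_of X)"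
    and qss: "quasi_selfsimilar L \<rho> X"
    and no_arc: "\<And>M g. \<not> Lipschitz_arc X M g"
  shows "\<exists>\<epsilon>. 0 < \<epsilon> \<and> \<epsilon> < 1 \<and> fine_chains_long X \<epsilon>"
proof (rule ccontr)
  assume neg: "\<not> ?thesis"
  obtain B where B: "0 < B" "\<And>x y. x \<in> mspace X \<Longrightarrow> y \<in> mspace X \<Longrightarrow> mdist X x y \<le> B"
    by (rule compact_mdist_bounded[OF cpt]) blast
  define M where "M = L * \<rho> + 2 * B"
  define c where "c = \<rho> / (2 * L)"
  have "0 < L * \<rho>"
    using assms by simp
  have M: "0 < M" "L * \<rho> \<le> M" "2 * B \<le> M"
    using \<open>0 < L * \<rho>\<close> B by (auto simp: M_def)
  have c: "0 < c" "c \<le> \<rho> / 2"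
    using assms by (auto simp: c_def field_simps)
  have "\<exists>p N. (\<forall>i\<le>N. p i \<in> mspace X) \<and> (\<forall>i<N. mdist X (p i) (p (Suc i)) \<le> M / Suc n) \<and>
      (\<Sum>i<N. mdist X (p i) (p (Suc i))) \<le> M \<and> c \<le> mdist X (p 0) (p N)" for n :: nat
  proof -
    define \<epsilon> where "\<epsilon> = 1 / (real n + 2)"
    have \<epsilon>: "0 < \<epsilon>" "\<epsilon> < 1" "\<epsilon> \<le> 1 / Suc n"
      by (auto simp: \<epsilon>_def field_simps)
    have "\<not> fine_chains_long X \<epsilon>"
      using neg \<epsilon> by blast
    then obtain p N where p: "\<And>i. i \<le> N \<Longrightarrow> p i \<in> mspace X"
      "\<And>i. i < N \<Longrightarrow> mdist X (p i) (p (Suc i)) \<le> \<epsilon> * mdist X (p 0) (p N)"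
      "(\<Sum>i<N. mdist X (p i) (p (Suc i))) < 2 * mdist X (p 0) (p N)"
      unfolding fine_chains_long_def by (auto simp: not_le)
    define D where "D = mdist X (p 0) (p N)"
    have "0 \<le> (\<Sum>i<N. mdist X (p i) (p (Suc i)))"
      by (simp add: sum_nonneg)
    then have "0 < D"
      using p(3) by (simp add: D_def)
    show ?thesis
    proof (cases "2 * D \<le> \<rho>")
      case True
      let ?B = "mcball_of X (p 0) (2 * D)"
      let ?k = "\<rho> / (2 * D)"
      have "0 < ?k"
        using \<open>0 < \<rho>\<close> \<open>0 < D\<close> by simp
      obtain \<Phi> where "biLipschitz_map L (scaled_metric ?k (submetric X ?B)) X \<Phi>"
        using qss True \<open>0 < D\<close> p(1)[of 0] unfolding quasi_selfsimilar_def
        by (meson le0 mult_pos_pos zero_less_numeral)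
      then have \<Phi>: "\<And>x. x \<in> ?B \<Longrightarrow> \<Phi> x \<in> mspace X"
        "\<And>x y. x \<in> ?B \<Longrightarrow> y \<in> ?B \<Longrightarrow> mdist X (\<Phi> x) (\<Phi> y) \<le> L * (?k * mdist X x y)"
        "\<And>x y. x \<in> ?B \<Longrightarrow> y \<in> ?B \<Longrightarrow> inverse L * (?k * mdist X x y) \<le> mdist X (\<Phi> x) (\<Phi> y)"
        unfolding biLipschitz_map_def mspace_scaled_metric[OF \<open>0 < ?k\<close>] mdist_scaled_metric[OF \<open>0 < ?k\<close>]
        by auto
      have pB: "p i \<in> ?B" if "i \<le> N" for i
      proof -
        have "mdist X (p 0) (p i) \<le> (\<Sum>i\<in>{0..<i}. mdist X (p i) (p (Suc i)))"
          using that p(1) by (intro mdist_chain_le) auto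
        also have "\<dots> \<le> (\<Sum>i<N. mdist X (p i) (p (Suc i)))"
          using that by (intro sum_mono2) auto
        finally show ?thesis
          using p that by (simp add: D_def)
      qed
      have "mdist X (\<Phi> (p i)) (\<Phi> (p (Suc i))) \<le> M / Suc n" if "i < N" for i
      proof -
        have "mdist X (\<Phi> (p i)) (\<Phi> (p (Suc i))) \<le> L * (?k * mdist X (p i) (p (Suc i)))"
          using that pB by (intro \<Phi>) auto
        also have "\<dots> \<le> L * (?k * (\<epsilon> * D))"
          using p(2)[OF that] \<open>0 < ?k\<close> \<open>1 \<le> L\<close> unfolding D_def by (intro mult_left_mono) auto
        also have "\<dots> = L * \<rho> / 2 * \<epsilon>"
          using \<open>0 < D\<close> by simp
        also have "\<dots> \<le> M * (1 / Suc n)"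
          using M \<epsilon> \<open>0 < L * \<rho>\<close> by (intro mult_mono) auto
        finally show ?thesis
          by simp
      qed
      moreover have "(\<Sum>i<N. mdist X (\<Phi> (p i)) (\<Phi> (p (Suc i)))) \<le> M"
      proof -
        have "(\<Sum>i<N. mdist X (\<Phi> (p i)) (\<Phi> (p (Suc i)))) \<le> (\<Sum>i<N. L * (?k * mdist X (p i) (p (Suc i))))"
          using pB by (intro sum_mono \<Phi>) auto
        also have "\<dots> = L * (?k * (\<Sum>i<N. mdist X (p i) (p (Suc i))))"
          by (simp add: sum_distrib_left)
        also have "\<dots> \<le> L * (?k * (2 * D))"
          using p(3) \<open>0 < ?k\<close> \<open>1 \<le> L\<close> unfolding D_def by (intro mult_left_mono) auto
        also have "\<dots> = L * \<rho>"
          using \<open>0 < D\<close> by simp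
        finally show ?thesis
          using M by simp
      qed
      moreover have "c \<le> mdist X (\<Phi> (p 0)) (\<Phi> (p N))"
      proof -
        have "c = inverse L * (?k * mdist X (p 0) (p N))"
          using \<open>0 < D\<close> by (simp add: c_def field_simps flip: D_def)
        also have "\<dots> \<le> mdist X (\<Phi> (p 0)) (\<Phi> (p N))"
          by (intro \<Phi> pB) auto
        finally show ?thesis .
      qed
      ultimately show ?thesis
        using \<Phi>(1) pB by (intro exI[of _ "\<lambda>i. \<Phi> (p i)"] exI[of _ N]) auto
    next
      case False
      have "D \<le> B"
        using B p by (simp add: D_def)
      have "mdist X (p i) (p (Suc i)) \<le> M / Suc n" if "i < N" for i
      proof -
        have "mdist X (p i) (p (Suc i)) \<le> \<epsilon> * D"
          using p(2)[OF that] by (simp add: D_def)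
        also have "\<dots> \<le> 1 / Suc n * M"
          using \<epsilon> \<open>D \<le> B\<close> \<open>0 < D\<close> M by (intro mult_mono) auto
        finally show ?thesis
          by simp
      qed
      then show ?thesis
        using p False \<open>D \<le> B\<close> M c by (intro exI[of _ p] exI[of _ N]) (auto simp: D_def)
    qed
  qed
  then have "\<exists>g. Lipschitz_arc X M g"
    by (rule Lipschitz_arc_from_chains[OF cpt M(1) c(1)])
  with no_arc show False
    by blast
qed

lemma Lipschitz_arc_continuous:
  assumes "Lipschitz_arc X M g"
  shows "continuous_map (top_of_set {0..1}) (mtopology_of X) g"
proof -
  have "Lipschitz_continuous_map (submetric euclidean_metric {0..1}) X g"
    using assms unfolding Lipschitz_continuous_map_def Lipschitz_arc_def
    by (auto simp: dist_real_def intro!: exI[of _ M])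
  then show ?thesis
    using Lipschitz_continuous_imp_continuous_map by (fastforce simp: mtopology_of_submetric)
qed

lemma Lipschitz_arc_rectifiable:
  assumes "Lipschitz_arc X M g"
  shows "rectifiable_curve X g" and "\<not> g constant_on {0..1}"
proof -
  have M: "0 < M" and g: "g \<in> {0..1} \<rightarrow> mspace X" and ne: "g 0 \<noteq> g 1"
    and Lip: "\<And>t u. t \<in> {0..1} \<Longrightarrow> u \<in> {0..1} \<Longrightarrow> mdist X (g t) (g u) \<le> M * \<bar>t - u\<bar>"
    using assms by (auto simp: Lipschitz_arc_def)
  have "curve_in X g"
    unfolding curve_in_def using assms by (rule Lipschitz_arc_continuous)
  moreover have "curve_length X g \<le> ennreal M"
    unfolding curve_length_def
  proof (rule SUP_least, clarify)
    fix N :: nat and t :: "nat \<Rightarrow> real"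
    assume t: "t 0 = 0" "t N = 1" "strict_mono_on {..N} t"
    have mono: "t i \<le> t j" if "i \<le> j" "j \<le> N" for i j
      using strict_mono_onD[OF t(3), of i j] that by (cases "i = j") auto
    have "(\<Sum>i<N. mdist X (g (t i)) (g (t (Suc i)))) \<le> (\<Sum>i<N. M * (t (Suc i) - t i))"
    proof (rule sum_mono)
      fix i assume "i \<in> {..<N}"
      then have "t 0 \<le> t i" "t i \<le> t (Suc i)" "t (Suc i) \<le> t N"
        by (auto intro: mono)
      then show "mdist X (g (t i)) (g (t (Suc i))) \<le> M * (t (Suc i) - t i)"
        using Lip[of "t i" "t (Suc i)"] t by simp
    qed
    also have "\<dots> = M"
      using t by (simp add: sum_lessThan_telescope flip: sum_distrib_left)
    finally show "ennreal (\<Sum>i<N. mdist X (g (t i)) (g (t (Suc i)))) \<le> ennreal M"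
      by (rule ennreal_leI)
  qed
  ultimately show "rectifiable_curve X g"
    unfolding rectifiable_curve_def by (metis ennreal_less_top infinity_ennreal_def order_le_less_trans)
  show "\<not> g constant_on {0..1}"
    using ne unfolding constant_on_def by (metis atLeastAtMost_iff order_refl zero_le_one)
qed

section \<open>Lipschitz functions\<close>

lemma Lip_iff:
  "f \<in> Lip X \<longleftrightarrow> (\<exists>L\<ge>0. \<forall>x\<in>mspace X. \<forall>y\<in>mspace X. \<bar>f x - f y\<bar> \<le> L * mdist X x y)"
proof
  assume "f \<in> Lip X"
  then show "\<exists>L\<ge>0. \<forall>x\<in>mspace X. \<forall>y\<in>mspace X. \<bar>f x - f y\<bar> \<le> L * mdist X x y"
    unfolding Lip_def Lipschitz_continuous_map_pos by (auto simp: dist_real_def intro: less_imp_le)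
next
  assume "\<exists>L\<ge>0. \<forall>x\<in>mspace X. \<forall>y\<in>mspace X. \<bar>f x - f y\<bar> \<le> L * mdist X x y"
  then show "f \<in> Lip X"
    unfolding Lip_def Lipschitz_continuous_map_def by (auto simp: dist_real_def)
qed

lemma LipI:
  assumes "\<And>x y. x \<in> mspace X \<Longrightarrow> y \<in> mspace X \<Longrightarrow> \<bar>f x - f y\<bar> \<le> L * mdist X x y" "0 \<le> L"
  shows "f \<in> Lip X" and "LIP X f \<le> L"
proof -
  show "f \<in> Lip X"
    using assms unfolding Lip_iff by blast
  show "LIP X f \<le> L"
    unfolding LIP_def using assms by (intro cInf_lower bdd_belowI[of _ 0]) auto
qed

lemma LIP_bound:
  assumes "f \<in> Lip X"
  shows "0 \<le> LIP X f"
    and "\<And>x y. x \<in> mspace X \<Longrightarrow> y \<in> mspace X \<Longrightarrow> \<bar>f x - f y\<bar> \<le> LIP X f * mdist X x y"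
proof -
  let ?S = "{L. 0 \<le> L \<and> (\<forall>x\<in>mspace X. \<forall>y\<in>mspace X. \<bar>f x - f y\<bar> \<le> L * mdist X x y)}"
  have ne: "?S \<noteq> {}"
    using assms unfolding Lip_iff by auto
  then show "0 \<le> LIP X f"
    unfolding LIP_def by (intro cInf_greatest) auto
  fix x y assume xy: "x \<in> mspace X" "y \<in> mspace X"
  show "\<bar>f x - f y\<bar> \<le> LIP X f * mdist X x y"
  proof (cases "mdist X x y = 0")
    case True
    with xy show ?thesis
      by simp
  next
    case False
    then have pos: "0 < mdist X x y"
      by (simp add: less_le)
    have "\<bar>f x - f y\<bar> / mdist X x y \<le> LIP X f"
      unfolding LIP_def using ne xy pos by (intro cInf_greatest) (auto simp: divide_le_eq)
    with pos show ?thesis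
      by (simp add: divide_le_eq)
  qed
qed

lemma Lip_b_bound:
  assumes "f \<in> Lip_b X"
  obtains B where "0 \<le> B" "\<And>x. x \<in> mspace X \<Longrightarrow> \<bar>f x\<bar> \<le> B"
proof -
  obtain B where "\<forall>y\<in>f ` mspace X. norm y \<le> B"
    using assms unfolding Lip_b_def bounded_iff by auto
  then show ?thesis
    by (intro that[of "max 0 B"]) auto
qed

lemma Lip_bI:
  assumes "f \<in> Lip X" and "\<And>x. x \<in> mspace X \<Longrightarrow> \<bar>f x\<bar> \<le> B"
  shows "f \<in> Lip_b X"
  using assms unfolding Lip_b_def bounded_iff by auto

lemma Lip_b_mult:
  assumes f: "f \<in> Lip_b X" and g: "g \<in> Lip_b X"
  shows "(\<lambda>x. f x * g x) \<in> Lip_b X"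
proof -
  obtain A where A: "0 \<le> A" "\<And>x. x \<in> mspace X \<Longrightarrow> \<bar>f x\<bar> \<le> A"
    using Lip_b_bound[OF f] by blast
  obtain B where B: "0 \<le> B" "\<And>x. x \<in> mspace X \<Longrightarrow> \<bar>g x\<bar> \<le> B"
    using Lip_b_bound[OF g] by blast
  have Lip: "f \<in> Lip X" "g \<in> Lip X"
    using f g by (auto simp: Lip_b_def)
  show ?thesis
  proof (rule Lip_bI)
    show "\<bar>f x * g x\<bar> \<le> A * B" if "x \<in> mspace X" for x
      unfolding abs_mult using A B that by (intro mult_mono) auto
    show "(\<lambda>x. f x * g x) \<in> Lip X"
    proof (rule LipI(1))
      fix x y assume xy: "x \<in> mspace X" "y \<in> mspace X"
      have "f x * g x - f y * g y = f x * (g x - g y) + g y * (f x - f y)"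
        by (simp add: algebra_simps)
      then have "\<bar>f x * g x - f y * g y\<bar> \<le> \<bar>f x\<bar> * \<bar>g x - g y\<bar> + \<bar>g y\<bar> * \<bar>f x - f y\<bar>"
        by (metis abs_mult abs_triangle_ineq)
      also have "\<dots> \<le> A * (LIP X g * mdist X x y) + B * (LIP X f * mdist X x y)"
        using A B LIP_bound[OF Lip(1)] LIP_bound[OF Lip(2)] xy by (intro add_mono mult_mono) auto
      finally show "\<bar>f x * g x - f y * g y\<bar> \<le> (A * LIP X g + B * LIP X f) * mdist X x y"
        by (simp add: algebra_simps)
    qed (use A B LIP_bound(1)[OF Lip(1)] LIP_bound(1)[OF Lip(2)] in auto)
  qed
qed

lemma Lip_linear_combination:
  assumes f: "f \<in> Lip X" and g: "g \<in> Lip X"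
  shows "(\<lambda>x. a * f x + b * g x) \<in> Lip X"
proof (rule LipI(1))
  fix x y assume xy: "x \<in> mspace X" "y \<in> mspace X"
  have "\<bar>(a * f x + b * g x) - (a * f y + b * g y)\<bar> = \<bar>a * (f x - f y) + b * (g x - g y)\<bar>"
    by (simp add: algebra_simps)
  also have "\<dots> \<le> \<bar>a\<bar> * \<bar>f x - f y\<bar> + \<bar>b\<bar> * \<bar>g x - g y\<bar>"
    by (metis abs_mult abs_triangle_ineq)
  also have "\<dots> \<le> \<bar>a\<bar> * (LIP X f * mdist X x y) + \<bar>b\<bar> * (LIP X g * mdist X x y)"
    using LIP_bound(2)[OF f xy] LIP_bound(2)[OF g xy] by (intro add_mono mult_left_mono) auto
  finally show "\<bar>(a * f x + b * g x) - (a * f y + b * g y)\<bar> \<le> (\<bar>a\<bar> * LIP X f + \<bar>b\<bar> * LIP X g) * mdist X x y"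
    by (simp add: algebra_simps)
qed (use LIP_bound(1)[OF f] LIP_bound(1)[OF g] in auto)

lemma Lip_b_linear_combination:
  assumes f: "f \<in> Lip_b X" and g: "g \<in> Lip_b X"
  shows "(\<lambda>x. a * f x + b * g x) \<in> Lip_b X"
proof -
  obtain A where A: "\<And>x. x \<in> mspace X \<Longrightarrow> \<bar>f x\<bar> \<le> A"
    using Lip_b_bound[OF f] by blast
  obtain B where B: "\<And>x. x \<in> mspace X \<Longrightarrow> \<bar>g x\<bar> \<le> B"
    using Lip_b_bound[OF g] by blast
  show ?thesis
  proof (rule Lip_bI)
    show "(\<lambda>x. a * f x + b * g x) \<in> Lip X"
      using f g by (intro Lip_linear_combination) (auto simp: Lip_b_def)
    fix x assume x: "x \<in> mspace X"
    have "\<bar>a * f x + b * g x\<bar> \<le> \<bar>a\<bar> * \<bar>f x\<bar> + \<bar>b\<bar> * \<bar>g x\<bar>"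
      by (metis abs_mult abs_triangle_ineq)
    also have "\<dots> \<le> \<bar>a\<bar> * A + \<bar>b\<bar> * B"
      using A[OF x] B[OF x] by (intro add_mono mult_left_mono) auto
    finally show "\<bar>a * f x + b * g x\<bar> \<le> \<bar>a\<bar> * A + \<bar>b\<bar> * B" .
  qed
qed

text \<open>
  A cutoff equal to \<open>1\<close> on the ball of radius \<open>r\<close> and supported in the ball of radius \<open>2 r\<close>.
\<close>

lemma Lip_bump:
  assumes "x \<in> mspace X" "0 < r"
  shows "(\<lambda>y. max 0 (min 1 (2 - mdist X x y / r))) \<in> Lip_b X" (is "?\<phi> \<in> _")
    and "(\<lambda>y. 1 - max 0 (min 1 (2 - mdist X x y / r))) \<in> Lip_b X"
proof -
  have Lip: "\<bar>?\<phi> y - ?\<phi> z\<bar> \<le> 1 / r * mdist X y z" if "y \<in> mspace X" "z \<in> mspace X" for y z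
  proof -
    have "\<bar>mdist X x y - mdist X x z\<bar> \<le> mdist X y z"
      using mdist_triangle[of x X y z] mdist_triangle[of x X z y] that assms
      by (simp add: mdist_commute abs_le_iff)
    then have "\<bar>mdist X x y / r - mdist X x z / r\<bar> \<le> 1 / r * mdist X y z"
      using \<open>0 < r\<close> by (simp add: divide_right_mono flip: diff_divide_distrib)
    then show ?thesis
      by linarith
  qed
  have *: "h \<in> Lip_b X"
    if "\<And>y z. y \<in> mspace X \<Longrightarrow> z \<in> mspace X \<Longrightarrow> \<bar>h y - h z\<bar> \<le> 1 / r * mdist X y z"
      and "\<And>y. \<bar>h y\<bar> \<le> 1" for h
    by (rule Lip_bI[where B = 1], rule LipI(1)[where L = "1 / r"]) (use that \<open>0 < r\<close> in simp_all)
  show "?\<phi> \<in> Lip_b X"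
    by (rule *[OF Lip]) simp_all
  have "\<bar>(1 - ?\<phi> y) - (1 - ?\<phi> z)\<bar> \<le> 1 / r * mdist X y z" if "y \<in> mspace X" "z \<in> mspace X" for y z
    using Lip[OF that] by linarith
  then show "(\<lambda>y. 1 - ?\<phi> y) \<in> Lip_b X"
    by (rule *) simp_all
qed

lemma Lip_b_integrable:
  assumes "f \<in> Lip_b X" and \<mu>: "space \<mu> = mspace X" "sets \<mu> = borel_sets_of X" "finite_measure \<mu>"
  shows "integrable \<mu> f"
proof -
  interpret finite_measure \<mu>
    by fact
  have "continuous_map (mtopology_of X) euclidean f"
    using assms(1) Lipschitz_continuous_imp_continuous_map[of X euclidean_metric f]
    by (simp add: Lip_b_def Lip_def)
  then have "openin (mtopology_of X) {x \<in> mspace X. f x \<in> S}" if "open S" for S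
    using that openin_continuous_map_preimage by fastforce
  then have "f -` S \<inter> space \<mu> \<in> sets \<mu>" if "open S" for S
    using that unfolding \<mu> borel_sets_of_def
    by (intro sigma_sets.Basic) (simp add: vimage_def Int_def conj_commute)
  then have "f \<in> borel_measurable \<mu>"
    by (rule borel_measurableI)
  moreover obtain B where "\<And>x. x \<in> mspace X \<Longrightarrow> \<bar>f x\<bar> \<le> B"
    using Lip_b_bound[OF assms(1)] by blast
  ultimately show ?thesis
    by (intro integrable_const_bound[of _ B] AE_I2) (simp_all add: \<mu>(1))
qed

section \<open>Infimal convolutions\<close>

text \<open>
  With \<open>\<omega>\<close> a multiple of the metric and \<open>A\<close> a subset this is McShane's Lipschitz extension from \<open>A\<close>; with \<open>A\<close>
  the whole space it is a regularisation of \<open>\<pi>\<close>. In both cases each \<open>x \<mapsto> \<pi> y + \<omega> x y\<close> is \<open>1\<close>-Lipschitz for \<open>\<omega>\<close>,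
  and so is their infimum.
\<close>

definition inf_convolution :: "'a set \<Rightarrow> ('a \<Rightarrow> real) \<Rightarrow> ('a \<Rightarrow> 'a \<Rightarrow> real) \<Rightarrow> 'a \<Rightarrow> real" where
  "inf_convolution A \<pi> \<omega> x = (INF y\<in>A. \<pi> y + \<omega> x y)"

lemma inf_convolution_le:
  assumes "bdd_below (\<pi> ` A)" "\<And>x y. 0 \<le> \<omega> x y" "y \<in> A"
  shows "inf_convolution A \<pi> \<omega> x \<le> \<pi> y + \<omega> x y"
proof -
  obtain m where "\<And>y. y \<in> A \<Longrightarrow> m \<le> \<pi> y"
    using assms(1) by (auto simp: bdd_below_def)
  then have "bdd_below ((\<lambda>y. \<pi> y + \<omega> x y) ` A)"
    using assms(2) by (intro bdd_belowI2[of _ m]) (simp add: add_increasing2)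
  then show ?thesis
    unfolding inf_convolution_def using assms(3) by (rule cINF_lower)
qed

lemma inf_convolution_Lipschitz:
  assumes "bdd_below (\<pi> ` A)" "A \<noteq> {}" "A \<subseteq> M" "\<And>x y. 0 \<le> \<omega> x y" "\<And>x y. \<omega> x y = \<omega> y x"
    and triangle: "\<And>x y z. x \<in> M \<Longrightarrow> y \<in> M \<Longrightarrow> z \<in> M \<Longrightarrow> \<omega> x z \<le> \<omega> x y + \<omega> y z"
    and "x \<in> M" "x' \<in> M"
  shows "\<bar>inf_convolution A \<pi> \<omega> x - inf_convolution A \<pi> \<omega> x'\<bar> \<le> \<omega> x x'"
proof -
  have *: "inf_convolution A \<pi> \<omega> x - \<omega> x x' \<le> inf_convolution A \<pi> \<omega> x'"
    if "x \<in> M" "x' \<in> M" for x x'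
    unfolding inf_convolution_def[of _ _ _ x']
  proof (rule cINF_greatest)
    fix y assume "y \<in> A"
    then have "inf_convolution A \<pi> \<omega> x \<le> \<pi> y + \<omega> x y"
      by (intro inf_convolution_le assms)
    also have "\<omega> x y \<le> \<omega> x x' + \<omega> x' y"
      using \<open>y \<in> A\<close> \<open>A \<subseteq> M\<close> that by (intro triangle) auto
    finally show "inf_convolution A \<pi> \<omega> x - \<omega> x x' \<le> \<pi> y + \<omega> x' y"
      by simp
  qed fact
  show ?thesis
    using *[of x x'] *[of x' x] assms(5)[of x x'] \<open>x \<in> M\<close> \<open>x' \<in> M\<close> by simp
qed

lemma Lip_bounded_on_compact:
  assumes cpt: "compact_space (mtopology_of X)" and "f \<in> Lip X"
  shows "bounded (f ` mspace X)"
proof -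
  have "continuous_map (mtopology_of X) euclidean f"
    using assms Lipschitz_continuous_imp_continuous_map[of X euclidean_metric f]
    by (simp add: Lip_def)
  then have "compactin euclidean (f ` mspace X)"
    using cpt image_compactin[of "mtopology_of X" "mspace X" euclidean f] by (simp add: compact_space_def)
  then show ?thesis
    by (simp add: compact_imp_bounded)
qed

section \<open>Currents vanish on functions with vanishing local Lipschitz constant\<close>

text \<open>
  The mass measure \<open>\<mu>\<close> is a parameter, since the estimates below add up integrals with respect to one
  and the same measure.
\<close>

locale current =
  fixes X :: "'a metric" and T :: "('a \<Rightarrow> real) \<Rightarrow> ('a \<Rightarrow> real) \<Rightarrow> real" and \<mu> :: "'a measure"
  assumes cpt: "compact_space (mtopology_of X)"
    and bilinear: "current_bilinear X T" and local: "current_local X T"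
    and continuous: "current_continuous X T"
    and \<mu>: "space \<mu> = mspace X" "sets \<mu> = borel_sets_of X" "finite_measure \<mu>"
    and mass: "\<And>f \<pi>. f \<in> Lip_b X \<Longrightarrow> \<pi> \<in> Lip X \<Longrightarrow> \<bar>T f \<pi>\<bar> \<le> LIP X \<pi> * (\<integral>x. \<bar>f x\<bar> \<partial>\<mu>)"
begin

lemma locality:
  assumes "f \<in> Lip_b X" "\<pi> \<in> Lip X" "openin (mtopology_of X) U" "{x \<in> mspace X. f x \<noteq> 0} \<subseteq> U"
    "\<pi> constant_on U"
  shows "T f \<pi> = 0"
  using local assms unfolding current_local_def by blast

lemma add_left:
  assumes "f \<in> Lip_b X" "g \<in> Lip_b X" "\<pi> \<in> Lip X"
  shows "T (\<lambda>x. a * f x + b * g x) \<pi> = a * T f \<pi> + b * T g \<pi>"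
  using bilinear assms unfolding current_bilinear_def by (elim conjE) (drule (1) bspec, drule (1) bspec, drule (1) bspec, simp)

lemma add_right:
  assumes "f \<in> Lip_b X" "\<pi> \<in> Lip X" "\<sigma> \<in> Lip X"
  shows "T f (\<lambda>x. a * \<pi> x + b * \<sigma> x) = a * T f \<pi> + b * T f \<sigma>"
  using bilinear assms unfolding current_bilinear_def by blast

text \<open>
  Only the Lipschitz constant of \<open>g\<close> near the support of \<open>f\<close> enters: the McShane extension \<open>h\<close> of
  \<open>g\<close> from \<open>U\<close> has the smaller constant globally, and locality gives \<open>T(f, g - h) = 0\<close>.
\<close>

lemma mass_restricted:
  assumes f: "f \<in> Lip_b X" and g: "g \<in> Lip X"
    and U: "openin (mtopology_of X) U" "{x \<in> mspace X. f x \<noteq> 0} \<subseteq> U"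
    and "0 \<le> \<epsilon>" and gU: "\<And>x y. x \<in> U \<Longrightarrow> y \<in> U \<Longrightarrow> \<bar>g x - g y\<bar> \<le> \<epsilon> * mdist X x y"
  shows "\<bar>T f g\<bar> \<le> \<epsilon> * (\<integral>x. \<bar>f x\<bar> \<partial>\<mu>)"
proof (cases "U = {}")
  case True
  then have "T f g = 0"
    using f g U by (intro locality[of _ _ U]) (auto simp: constant_on_def)
  with \<open>0 \<le> \<epsilon>\<close> show ?thesis
    by simp
next
  case False
  have UX: "U \<subseteq> mspace X"
    using openin_subset[OF U(1)] by simp
  have "bdd_below (g ` U)"
    using Lip_bounded_on_compact[OF cpt g] UX
    by (meson bdd_below_mono bounded_imp_bdd_below image_mono)
  define h where "h = inf_convolution U g (\<lambda>x y. \<epsilon> * mdist X x y)"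
  have Lip_h: "\<bar>h x - h y\<bar> \<le> \<epsilon> * mdist X x y" if "x \<in> mspace X" "y \<in> mspace X" for x y
    unfolding h_def
  proof (rule inf_convolution_Lipschitz[OF \<open>bdd_below (g ` U)\<close> False UX _ _ _ that])
    show "\<epsilon> * mdist X x z \<le> \<epsilon> * mdist X x y + \<epsilon> * mdist X y z"
      if "x \<in> mspace X" "y \<in> mspace X" "z \<in> mspace X" for x y z
      using mdist_triangle[OF that] \<open>0 \<le> \<epsilon>\<close> by (simp add: mult_left_mono flip: distrib_left)
  qed (use \<open>0 \<le> \<epsilon>\<close> in \<open>auto simp: mdist_commute\<close>)
  then have h: "h \<in> Lip X" "LIP X h \<le> \<epsilon>"
    using \<open>0 \<le> \<epsilon>\<close> by (auto intro: LipI)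
  have hU: "h x = g x" if "x \<in> U" for x
  proof (rule antisym)
    have "mdist X x x = 0"
      using that UX by auto
    then show "h x \<le> g x"
      unfolding h_def using inf_convolution_le[OF \<open>bdd_below (g ` U)\<close> _ that, of "\<lambda>x y. \<epsilon> * mdist X x y" x] \<open>0 \<le> \<epsilon>\<close>
      by simp
    show "g x \<le> h x"
      unfolding h_def inf_convolution_def
    proof (rule cINF_greatest[OF False])
      fix y assume "y \<in> U"
      then show "g x \<le> g y + \<epsilon> * mdist X x y"
        using gU[OF that \<open>y \<in> U\<close>] by linarith
    qed
  qed
  have diff: "(\<lambda>x. 1 * g x + (-1) * h x) \<in> Lip X"
  proof (rule LipI(1))
    fix x y assume "x \<in> mspace X" "y \<in> mspace X"
    then show "\<bar>(1 * g x + (-1) * h x) - (1 * g y + (-1) * h y)\<bar> \<le> (LIP X g + \<epsilon>) * mdist X x y"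
      using Lip_h[of x y] LIP_bound(2)[OF g, of x y] by (simp add: distrib_right)
  qed (use \<open>0 \<le> \<epsilon>\<close> LIP_bound(1)[OF g] in simp)
  have "T f (\<lambda>x. 1 * g x + (-1) * h x) = 0"
    by (rule locality[OF f diff U]) (auto simp: constant_on_def hU)
  moreover have "T f (\<lambda>x. 1 * g x + (-1) * h x) = 1 * T f g + (-1) * T f h"
    by (rule add_right[OF f g h(1)])
  ultimately have "T f g = T f h"
    by simp
  then have "\<bar>T f g\<bar> \<le> LIP X h * (\<integral>x. \<bar>f x\<bar> \<partial>\<mu>)"
    using mass[OF f h(1)] by simp
  also have "\<dots> \<le> \<epsilon> * (\<integral>x. \<bar>f x\<bar> \<partial>\<mu>)"
    using h by (intro mult_right_mono) auto
  finally show ?thesis .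
qed

text \<open>
  Cover \<open>X\<close> by finitely many balls so small that \<open>g\<close> has Lipschitz constant \<open>\<epsilon>\<close> on each doubled ball.
  The induction over these balls splits \<open>f = f \<phi> + f (1 - \<phi>)\<close> with a cutoff \<open>\<phi>\<close>: the first summand lives
  on one doubled ball, the second vanishes on the ball itself and is left to the others. As
  \<open>0 \<le> \<phi> \<le> 1\<close>, the integrals of the absolute values add up exactly, so \<open>\<bar>T(f, g)\<bar> \<le> \<epsilon> \<integral>\<bar>f\<bar> d\<mu>\<close>
  with no loss from the number of balls.
\<close>

lemma little_Lipschitz_imp_zero:
  assumes f: "f \<in> Lip_b X" and g: "g \<in> Lip X"
    and little: "\<And>\<epsilon>. 0 < \<epsilon> \<Longrightarrow> \<exists>\<delta>>0. \<forall>x\<in>mspace X. \<forall>y\<in>mspace X.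
      mdist X x y < \<delta> \<longrightarrow> \<bar>g x - g y\<bar> \<le> \<epsilon> * mdist X x y"
  shows "T f g = 0"
proof -
  have bound: "\<bar>T f g\<bar> \<le> \<epsilon> * (\<integral>x. \<bar>f x\<bar> \<partial>\<mu>)" if "0 < \<epsilon>" for \<epsilon>
  proof -
    obtain \<delta> where \<delta>: "0 < \<delta>" "\<And>x y. x \<in> mspace X \<Longrightarrow> y \<in> mspace X \<Longrightarrow> mdist X x y < \<delta> \<Longrightarrow>
      \<bar>g x - g y\<bar> \<le> \<epsilon> * mdist X x y"
      using little[OF \<open>0 < \<epsilon>\<close>] by blast
    define r where "r = \<delta> / 4"
    have r: "0 < r"
      using \<delta> by (simp add: r_def)
    interpret Metric_space "mspace X" "mdist X"
      by simp
    have "mtotally_bounded (mspace X)"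
      using cpt compact_space_eq_mcomplete_mtotally_bounded by (simp add: mtopology_of_def)
    then have "\<exists>K. finite K \<and> K \<subseteq> mspace X \<and> mspace X \<subseteq> (\<Union>x\<in>K. mball_of X x r)"
      using r by (simp add: mtotally_bounded_def mball_of_def)
    then obtain K where K: "finite K" "K \<subseteq> mspace X" "mspace X \<subseteq> (\<Union>x\<in>K. mball_of X x r)"
      by blast
    have "\<bar>T f g\<bar> \<le> \<epsilon> * (\<integral>x. \<bar>f x\<bar> \<partial>\<mu>)"
      if "f \<in> Lip_b X" "{x \<in> mspace X. f x \<noteq> 0} \<subseteq> (\<Union>x\<in>K. mball_of X x r)" for f
      using K(1,2) that
    proof (induction K arbitrary: f rule: finite_induct)
      case empty
      then have "T f g = 0"
        using g by (intro locality[of _ _ "{}"]) (auto simp: constant_on_def)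
      with \<open>0 < \<epsilon>\<close> show ?case
        by simp
    next
      case (insert x K)
      define \<phi> where "\<phi> y = max 0 (min 1 (2 - mdist X x y / r))" for y
      have x: "x \<in> mspace X"
        using insert.prems by simp
      have \<phi>: "\<phi> \<in> Lip_b X" "(\<lambda>y. 1 - \<phi> y) \<in> Lip_b X" "\<And>y. 0 \<le> \<phi> y" "\<And>y. \<phi> y \<le> 1"
        using Lip_bump[OF x r] by (auto simp: \<phi>_def[abs_def])
      have near: "(\<lambda>y. f y * \<phi> y) \<in> Lip_b X" and far: "(\<lambda>y. f y * (1 - \<phi> y)) \<in> Lip_b X"
        using insert.prems \<phi> by (auto intro: Lip_b_mult)
      have "\<bar>T (\<lambda>y. f y * \<phi> y) g\<bar> \<le> \<epsilon> * (\<integral>y. \<bar>f y * \<phi> y\<bar> \<partial>\<mu>)"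
      proof (rule mass_restricted[OF near g, of "mball_of X x (2 * r)"])
        show "openin (mtopology_of X) (mball_of X x (2 * r))"
          by (simp add: mball_of_def mtopology_of_def)
        show "{y \<in> mspace X. f y * \<phi> y \<noteq> 0} \<subseteq> mball_of X x (2 * r)"
        proof
          fix y assume "y \<in> {y \<in> mspace X. f y * \<phi> y \<noteq> 0}"
          then have "y \<in> mspace X" "0 < 2 - mdist X x y / r"
            by (auto simp: \<phi>_def)
          with x r show "y \<in> mball_of X x (2 * r)"
            by (simp add: field_simps)
        qed
        fix y z assume yz: "y \<in> mball_of X x (2 * r)" "z \<in> mball_of X x (2 * r)"
        then have "mdist X y z < \<delta>"
          using mdist_triangle[of y X x z] by (simp add: mdist_commute r_def)
        with yz show "\<bar>g y - g z\<bar> \<le> \<epsilon> * mdist X y z"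
          by (intro \<delta>(2)) auto
      qed (use \<open>0 < \<epsilon>\<close> in simp)
      moreover have "\<bar>T (\<lambda>y. f y * (1 - \<phi> y)) g\<bar> \<le> \<epsilon> * (\<integral>y. \<bar>f y * (1 - \<phi> y)\<bar> \<partial>\<mu>)"
      proof (rule insert.IH)
        show "{y \<in> mspace X. f y * (1 - \<phi> y) \<noteq> 0} \<subseteq> (\<Union>x\<in>K. mball_of X x r)"
        proof
          fix y assume y: "y \<in> {y \<in> mspace X. f y * (1 - \<phi> y) \<noteq> 0}"
          then have "y \<in> {x \<in> mspace X. f x \<noteq> 0}" "\<phi> y \<noteq> 1"
            by auto
          moreover from this(1) have "y \<in> (\<Union>x\<in>insert x K. mball_of X x r)"
            using insert.prems(3) by blast
          moreover have "\<phi> y = 1" if "mdist X x y < r"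
            using that r by (simp add: \<phi>_def field_simps)
          ultimately show "y \<in> (\<Union>x\<in>K. mball_of X x r)"
            by auto
        qed
      qed (use insert.prems far in auto)
      moreover have "T f g = T (\<lambda>y. f y * \<phi> y) g + T (\<lambda>y. f y * (1 - \<phi> y)) g"
      proof -
        have "f = (\<lambda>y. 1 * (f y * \<phi> y) + 1 * (f y * (1 - \<phi> y)))"
          by (auto simp: algebra_simps)
        then have "T f g = T (\<lambda>y. 1 * (f y * \<phi> y) + 1 * (f y * (1 - \<phi> y))) g"
          by (rule arg_cong)
        also have "\<dots> = 1 * T (\<lambda>y. f y * \<phi> y) g + 1 * T (\<lambda>y. f y * (1 - \<phi> y)) g"
          by (rule add_left[OF near far g])
        finally show ?thesis
          by simp
      qed
      moreover have "(\<integral>y. \<bar>f y\<bar> \<partial>\<mu>) = (\<integral>y. \<bar>f y * \<phi> y\<bar> \<partial>\<mu>) + (\<integral>y. \<bar>f y * (1 - \<phi> y)\<bar> \<partial>\<mu>)"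
      proof -
        have "\<bar>f y\<bar> = \<bar>f y * \<phi> y\<bar> + \<bar>f y * (1 - \<phi> y)\<bar>" for y
        proof -
          have "\<bar>\<phi> y\<bar> = \<phi> y" "\<bar>1 - \<phi> y\<bar> = 1 - \<phi> y"
            using \<phi>(3,4)[of y] by auto
          then show ?thesis
            unfolding abs_mult by (simp only: flip: distrib_left) simp
        qed
        then show ?thesis
          using Lip_b_integrable[OF near \<mu>] Lip_b_integrable[OF far \<mu>]
          by (simp add: Bochner_Integration.integral_add)
      qed
      ultimately show ?case
        by (simp add: distrib_left)
    qed
    with f K(3) show ?thesis
      by blast
  qed
  have "\<bar>T f g\<bar> \<le> 0"
  proof (rule field_le_epsilon)
    fix e :: real assume "0 < e"
    define I where "I = (\<integral>x. \<bar>f x\<bar> \<partial>\<mu>)"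
    have "0 \<le> I"
      by (simp add: I_def)
    have "\<bar>T f g\<bar> \<le> e / (I + 1) * I"
      unfolding I_def using \<open>0 < e\<close> \<open>0 \<le> I\<close> by (intro bound) (simp add: I_def[symmetric])
    also have "\<dots> \<le> e"
      using \<open>0 < e\<close> \<open>0 \<le> I\<close> by (simp add: field_simps)
    finally show "\<bar>T f g\<bar> \<le> 0 + e"
      by simp
  qed
  then show ?thesis
    by simp
qed

end

section \<open>Currents in snowflakes\<close>

text \<open>
  The modulus is \<open>min (n t) (t\<^sup>\<alpha>)\<close>, written with its decreasing slope as a factor. It differs from \<open>t\<^sup>\<alpha>\<close>
  only where \<open>t\<^bsup>1-\<alpha>\<^esup> < 1 / n\<close>, and there \<open>t\<^sup>\<alpha>\<close> is small.
\<close>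

lemma snowflake_modulus_bounds:
  fixes n t \<alpha> :: real
  assumes "0 < n" "0 < \<alpha>" "\<alpha> < 1" "0 \<le> t"
  shows "t * min n (t powr (\<alpha> - 1)) \<le> n * t" "t * min n (t powr (\<alpha> - 1)) \<le> t powr \<alpha>"
    and "t powr \<alpha> \<le> t * min n (t powr (\<alpha> - 1)) + (1 / n) powr (\<alpha> / (1 - \<alpha>))"
    and "0 \<le> t * min n (t powr (\<alpha> - 1))"
proof -
  have t: "t powr \<alpha> = t * t powr (\<alpha> - 1)"
    using assms by (simp add: powr_diff)
  show "t * min n (t powr (\<alpha> - 1)) \<le> n * t"
    using assms by (subst mult.commute) (intro mult_right_mono, auto)
  show "t * min n (t powr (\<alpha> - 1)) \<le> t powr \<alpha>"
    unfolding t using assms by (intro mult_left_mono) auto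
  show "0 \<le> t * min n (t powr (\<alpha> - 1))"
    using assms by simp
  show "t powr \<alpha> \<le> t * min n (t powr (\<alpha> - 1)) + (1 / n) powr (\<alpha> / (1 - \<alpha>))"
  proof (cases "t powr (\<alpha> - 1) \<le> n")
    case True
    then show ?thesis
      by (simp add: t)
  next
    case False
    then have "0 < t"
      using assms by (cases "t = 0") auto
    have "t powr (1 - \<alpha>) = inverse (t powr (\<alpha> - 1))"
      by (simp add: powr_minus[symmetric])
    also have "\<dots> \<le> 1 / n"
      using False \<open>0 < n\<close> by (simp add: inverse_eq_divide frac_le)
    finally have "(t powr (1 - \<alpha>)) powr (\<alpha> / (1 - \<alpha>)) \<le> (1 / n) powr (\<alpha> / (1 - \<alpha>))"
      using assms by (intro powr_mono2) auto
    moreover have "(t powr (1 - \<alpha>)) powr (\<alpha> / (1 - \<alpha>)) = t powr \<alpha>"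
      using assms by (simp add: powr_powr)
    moreover have "0 \<le> t * min n (t powr (\<alpha> - 1))"
      using assms by simp
    ultimately show ?thesis
      by linarith
  qed
qed

lemma snowflake_modulus_triangle:
  fixes n \<alpha> a b c :: real
  assumes "0 < n" "0 < \<alpha>" "\<alpha> < 1" "0 \<le> a" "0 \<le> b" "0 \<le> c" "c \<le> a + b"
  shows "c * min n (c powr (\<alpha> - 1)) \<le> a * min n (a powr (\<alpha> - 1)) + b * min n (b powr (\<alpha> - 1))"
proof (rule decreasing_slope_triangle)
  fix s t :: real
  show "min n (t powr (\<alpha> - 1)) \<le> min n (s powr (\<alpha> - 1))" if "0 < s" "s \<le> t"
    using that assms by (intro min.mono powr_mono2') auto
  have *: "x * min n (x powr (\<alpha> - 1)) = min (n * x) (x powr \<alpha>)" if "0 \<le> x" for x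
    using that by (simp add: min_mult_distrib_left powr_diff mult.commute)
  show "s * min n (s powr (\<alpha> - 1)) \<le> t * min n (t powr (\<alpha> - 1))" if "0 \<le> s" "s \<le> t"
    using that assms by (simp only: *) (intro min.mono mult_left_mono powr_mono2, auto)
qed (use assms in auto)

text \<open>
  In terms of \<open>\<rho>\<close>, the function \<open>\<pi>\<close> is \<open>\<alpha>\<close>-Hoelder with some constant \<open>A\<close>. Infimal convolution with \<open>A min (n \<rho>) (\<rho>\<^sup>\<alpha>)\<close>,
  which is a metric up to the factor \<open>A\<close>, gives functions that are \<open>\<rho>\<close>-Lipschitz and, uniformly in \<open>n\<close>,
  \<open>d\<close>-Lipschitz. Convolution with \<open>A n \<rho>\<close> alone would not control the \<open>d\<close>-Lipschitz constants, as
  the continuity of currents requires.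
\<close>

lemma snowflake_approximation:
  assumes cpt: "compact_space (mtopology_of X)" and cmp: "snowflake_comparable X Y \<alpha> C"
    and \<pi>: "\<pi> \<in> Lip X"
  obtains \<pi>s :: "nat \<Rightarrow> 'a \<Rightarrow> real" and L K where "0 \<le> L" "\<And>n. 0 \<le> K n"
    "\<And>n x y. x \<in> mspace X \<Longrightarrow> y \<in> mspace X \<Longrightarrow> \<bar>\<pi>s n x - \<pi>s n y\<bar> \<le> L * mdist X x y"
    "\<And>n x y. x \<in> mspace X \<Longrightarrow> y \<in> mspace X \<Longrightarrow> \<bar>\<pi>s n x - \<pi>s n y\<bar> \<le> K n * mdist Y x y"
    "\<And>x. x \<in> mspace X \<Longrightarrow> (\<lambda>n. \<pi>s n x) \<longlonglongrightarrow> \<pi> x"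
proof (cases "mspace X = {}")
  case True
  then show ?thesis
    by (intro that[of 0 "\<lambda>_. 0" "\<lambda>_. \<pi>"]) auto
next
  case False
  have Y: "mspace Y = mspace X" and \<alpha>: "0 < \<alpha>" "\<alpha> < 1" and C: "1 \<le> C"
    and YX: "\<And>x y. x \<in> mspace X \<Longrightarrow> y \<in> mspace X \<Longrightarrow> mdist Y x y powr \<alpha> \<le> C * mdist X x y"
    and XY: "\<And>x y. x \<in> mspace X \<Longrightarrow> y \<in> mspace X \<Longrightarrow> mdist X x y \<le> C * mdist Y x y powr \<alpha>"
    using cmp unfolding snowflake_comparable_def by auto
  define A where "A = LIP X \<pi> * C"
  have A: "0 \<le> A"
    using C LIP_bound(1)[OF \<pi>] by (simp add: A_def)
  have \<pi>Y: "\<bar>\<pi> x - \<pi> y\<bar> \<le> A * mdist Y x y powr \<alpha>" if "x \<in> mspace X" "y \<in> mspace X" for x y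
  proof -
    have "\<bar>\<pi> x - \<pi> y\<bar> \<le> LIP X \<pi> * mdist X x y"
      by (rule LIP_bound(2)[OF \<pi> that])
    also have "\<dots> \<le> LIP X \<pi> * (C * mdist Y x y powr \<alpha>)"
      using XY[OF that] LIP_bound(1)[OF \<pi>] by (intro mult_left_mono)
    finally show ?thesis
      by (simp add: A_def mult.assoc)
  qed
  have bdd: "bdd_below (\<pi> ` mspace X)"
    by (rule bounded_imp_bdd_below[OF Lip_bounded_on_compact[OF cpt \<pi>]])
  define h where "h n t = t * min (real (Suc n)) (t powr (\<alpha> - 1))" for n t
  note h_bounds = snowflake_modulus_bounds[OF _ \<alpha>, of "real (Suc _)", folded h_def, simplified of_nat_0_less_iff zero_less_Suc, OF TrueI]
  define \<omega> where "\<omega> n x y = A * h n (mdist Y x y)" for n x y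
  define \<pi>s where "\<pi>s n = inf_convolution (mspace X) \<pi> (\<omega> n)" for n
  have \<omega>_nonneg: "0 \<le> \<omega> n x y" for n x y
    using A h_bounds(4) by (simp add: \<omega>_def)
  have Lip_\<omega>: "\<bar>\<pi>s n x - \<pi>s n y\<bar> \<le> \<omega> n x y" if "x \<in> mspace X" "y \<in> mspace X" for n x y
    unfolding \<pi>s_def
  proof (rule inf_convolution_Lipschitz[OF bdd False order_refl \<omega>_nonneg _ _ that])
    show "\<omega> n x z \<le> \<omega> n x y + \<omega> n y z"
      if "x \<in> mspace X" "y \<in> mspace X" "z \<in> mspace X" for x y z
    proof -
      have "h n (mdist Y x z) \<le> h n (mdist Y x y) + h n (mdist Y y z)"
        unfolding h_def using \<alpha> that Y by (intro snowflake_modulus_triangle mdist_triangle) auto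
      with A show ?thesis
        unfolding \<omega>_def by (simp add: mult_left_mono flip: distrib_left)
    qed
  qed (simp add: \<omega>_def mdist_commute)
  show ?thesis
  proof (rule that[of "A * C" "\<lambda>n. A * real (Suc n)" \<pi>s])
    fix n x y assume xy: "x \<in> mspace X" "y \<in> mspace X"
    have "\<omega> n x y \<le> A * (real (Suc n) * mdist Y x y)"
      unfolding \<omega>_def using A h_bounds(1) by (intro mult_left_mono) auto
    with Lip_\<omega>[OF xy, of n] show "\<bar>\<pi>s n x - \<pi>s n y\<bar> \<le> A * real (Suc n) * mdist Y x y"
      by (simp add: mult.assoc)
    have "\<omega> n x y \<le> A * mdist Y x y powr \<alpha>"
      unfolding \<omega>_def using A h_bounds(2) by (intro mult_left_mono) auto
    also have "\<dots> \<le> A * (C * mdist X x y)"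
      using A YX[OF xy] by (intro mult_left_mono)
    finally show "\<bar>\<pi>s n x - \<pi>s n y\<bar> \<le> A * C * mdist X x y"
      using Lip_\<omega>[OF xy, of n] by (simp add: mult.assoc)
  next
    fix x assume x: "x \<in> mspace X"
    define e where "e n = A * (1 / real (Suc n)) powr (\<alpha> / (1 - \<alpha>))" for n
    have "(\<lambda>n. 1 / real (Suc n)) \<longlonglongrightarrow> 0"
      using LIMSEQ_inverse_real_of_nat by (simp add: inverse_eq_divide)
    then have "(\<lambda>n. (1 / real (Suc n)) powr (\<alpha> / (1 - \<alpha>))) \<longlonglongrightarrow> 0"
      using \<alpha> by (intro tendsto_zero_powrI[OF _ tendsto_const]) auto
    then have "e \<longlonglongrightarrow> 0"
      unfolding e_def by (rule tendsto_mult_right_zero)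
    have upper: "\<pi>s n x \<le> \<pi> x" for n
    proof -
      have "\<pi>s n x \<le> \<pi> x + \<omega> n x x"
        unfolding \<pi>s_def by (rule inf_convolution_le[OF bdd \<omega>_nonneg x])
      also have "\<omega> n x x = 0"
        using x Y by (simp add: \<omega>_def h_def)
      finally show ?thesis
        by simp
    qed
    have lower: "\<pi> x - e n \<le> \<pi>s n x" for n
      unfolding \<pi>s_def inf_convolution_def
    proof (rule cINF_greatest[OF False])
      fix y assume y: "y \<in> mspace X"
      have "A * mdist Y x y powr \<alpha> \<le> A * (h n (mdist Y x y) + (1 / real (Suc n)) powr (\<alpha> / (1 - \<alpha>)))"
        using A h_bounds(3) by (intro mult_left_mono) auto
      then show "\<pi> x - e n \<le> \<pi> y + \<omega> n x y"
        using \<pi>Y[OF x y] by (simp add: \<omega>_def e_def distrib_left)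
    qed
    have lim: "(\<lambda>n. \<pi> x - e n) \<longlonglongrightarrow> \<pi> x"
      using tendsto_diff[OF tendsto_const \<open>e \<longlonglongrightarrow> 0\<close>] by simp
    show "(\<lambda>n. \<pi>s n x) \<longlonglongrightarrow> \<pi> x"
      by (rule real_tendsto_sandwich[OF _ _ lim tendsto_const]) (use upper lower in auto)
  qed (use A C in auto)
qed

text \<open>
  The point is that \<open>\<rho> \<le> (C d)\<^sup>s\<close> with \<open>s = 1 / \<alpha> > 1\<close>.
\<close>

lemma snowflake_Lipschitz_is_little_Lipschitz:
  assumes cmp: "snowflake_comparable X Y \<alpha> C" and "0 \<le> K"
    and g: "\<And>x y. x \<in> mspace X \<Longrightarrow> y \<in> mspace X \<Longrightarrow> \<bar>g x - g y\<bar> \<le> K * mdist Y x y" and "0 < \<epsilon>"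
  shows "\<exists>\<delta>>0. \<forall>x\<in>mspace X. \<forall>y\<in>mspace X. mdist X x y < \<delta> \<longrightarrow> \<bar>g x - g y\<bar> \<le> \<epsilon> * mdist X x y"
proof -
  have \<alpha>: "0 < \<alpha>" "\<alpha> < 1" and C: "1 \<le> C"
    and YX: "\<And>x y. x \<in> mspace X \<Longrightarrow> y \<in> mspace X \<Longrightarrow> mdist Y x y powr \<alpha> \<le> C * mdist X x y"
    using cmp unfolding snowflake_comparable_def by auto
  define s where "s = 1 / \<alpha>"
  have s: "1 < s"
    using \<alpha> by (simp add: s_def)
  have "((\<lambda>t. t powr (s - 1)) \<longlongrightarrow> 0) (at_right 0)"
    using s by (intro tendsto_zero_powrI) (auto simp: eventually_at_filter)
  then have "((\<lambda>t. K * C powr s * t powr (s - 1)) \<longlongrightarrow> 0) (at_right 0)"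
    by (rule tendsto_mult_right_zero)
  then have "\<forall>\<^sub>F t in at_right 0. K * C powr s * t powr (s - 1) < \<epsilon>"
    using \<open>0 < \<epsilon>\<close> by (rule order_tendstoD)
  then obtain \<delta> where \<delta>: "0 < \<delta>" "\<And>t. 0 < t \<Longrightarrow> t < \<delta> \<Longrightarrow> K * C powr s * t powr (s - 1) < \<epsilon>"
    unfolding eventually_at_right_field by auto
  have "\<bar>g x - g y\<bar> \<le> \<epsilon> * mdist X x y"
    if xy: "x \<in> mspace X" "y \<in> mspace X" "mdist X x y < \<delta>" for x y
  proof (cases "x = y")
    case False
    define t where "t = mdist X x y"
    have "t \<noteq> 0"
      using False xy by (simp add: t_def)
    then have t: "0 < t" "t < \<delta>"
      using xy by (auto simp: t_def less_le)
    have "mdist Y x y = (mdist Y x y powr \<alpha>) powr s"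
      using \<alpha> by (simp add: powr_powr s_def)
    also have "\<dots> \<le> (C * t) powr s"
      using YX xy s by (intro powr_mono2) (auto simp: t_def)
    also have "\<dots> = C powr s * t powr (s - 1) * t"
      using C t by (simp add: powr_mult powr_diff)
    finally have "K * mdist Y x y \<le> K * (C powr s * t powr (s - 1) * t)"
      using \<open>0 \<le> K\<close> by (rule mult_left_mono)
    also have "\<dots> \<le> \<epsilon> * t"
      using \<delta>(2)[OF t] t mult_right_mono[of "K * C powr s * t powr (s - 1)" \<epsilon> t] by (simp add: mult.assoc)
    finally show ?thesis
      using g[of x y] xy by (simp add: t_def)
  qed (use xy in simp)
  with \<open>0 < \<delta>\<close> show ?thesis
    by blast
qed

lemma zero_in_metric_1_currents: "(\<lambda>f \<pi>. 0) \<in> \<^bold>M\<^sub>1 X"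
proof -
  define \<mu> where "\<mu> = null_measure (sigma (mspace X) {U. openin (mtopology_of X) U})"
  have "{U. openin (mtopology_of X) U} \<subseteq> Pow (mspace X)"
    using openin_subset by fastforce
  then have "space \<mu> = mspace X" "sets \<mu> = borel_sets_of X"
    by (auto simp: \<mu>_def borel_sets_of_def)
  moreover have "finite_measure \<mu>"
    by (rule finite_measureI) (simp add: \<mu>_def)
  moreover have "\<bar>0\<bar> \<le> LIP X \<pi> * (\<integral>x. \<bar>f x\<bar> \<partial>\<mu>)" if "\<pi> \<in> Lip X" for f \<pi>
    using LIP_bound(1)[OF that] by simp
  ultimately have "current_finite_mass X (\<lambda>f \<pi>. 0)"
    unfolding current_finite_mass_def by blast
  then show ?thesis
    by (simp add: metric_1_currents_def current_bilinear_def current_local_def current_continuous_def)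
qed

lemma snowflake_no_currents:
  assumes cpt: "compact_space (mtopology_of X)" and cmp: "snowflake_comparable X Y \<alpha> C"
  shows "\<^bold>M\<^sub>1 X = {\<lambda>f \<pi>. 0}"
proof -
  have "T = (\<lambda>f \<pi>. 0)" if T: "T \<in> \<^bold>M\<^sub>1 X" for T
  proof (intro ext)
    fix f \<pi>
    have "current_finite_mass X T"
      using T by (simp add: metric_1_currents_def)
    then obtain \<mu> where \<mu>: "space \<mu> = mspace X" "sets \<mu> = borel_sets_of X" "finite_measure \<mu>"
      "\<forall>f\<in>Lip_b X. \<forall>\<pi>\<in>Lip X. \<bar>T f \<pi>\<bar> \<le> LIP X \<pi> * (\<integral>x. \<bar>f x\<bar> \<partial>\<mu>)"
      unfolding current_finite_mass_def by (elim exE conjE)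
    interpret current X T \<mu>
      by (rule current.intro) (use T \<mu> cpt in \<open>simp_all add: metric_1_currents_def\<close>)
    show "T f \<pi> = 0"
    proof (cases "f \<in> Lip_b X \<and> \<pi> \<in> Lip X")
      case False
      then show ?thesis
        using T by (auto simp: metric_1_currents_def)
    next
      case True
      then have f: "f \<in> Lip_b X" and \<pi>: "\<pi> \<in> Lip X"
        by auto
      obtain \<pi>s L K where "0 \<le> L" and K: "\<And>n. 0 \<le> K n"
        and L: "\<And>n x y. x \<in> mspace X \<Longrightarrow> y \<in> mspace X \<Longrightarrow> \<bar>\<pi>s n x - \<pi>s n y\<bar> \<le> L * mdist X x y"
        and KY: "\<And>n x y. x \<in> mspace X \<Longrightarrow> y \<in> mspace X \<Longrightarrow> \<bar>\<pi>s n x - \<pi>s n y\<bar> \<le> K n * mdist Y x y"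
        and lim: "\<And>x. x \<in> mspace X \<Longrightarrow> (\<lambda>n. \<pi>s n x) \<longlonglongrightarrow> \<pi> x"
        by (rule snowflake_approximation[OF cpt cmp \<pi>]) blast
      have \<pi>s: "\<pi>s n \<in> Lip X" "LIP X (\<pi>s n) \<le> L" for n
        using L \<open>0 \<le> L\<close> by (auto intro: LipI)
      have "T f (\<pi>s n) = 0" for n
        using snowflake_Lipschitz_is_little_Lipschitz[OF cmp K KY]
        by (intro little_Lipschitz_imp_zero f \<pi>s)
      moreover have "(\<lambda>n. T f (\<pi>s n)) \<longlonglongrightarrow> T f \<pi>"
      proof -
        have "bdd_above (range (\<lambda>n. LIP X (\<pi>s n)))"
          using \<pi>s by (intro bdd_aboveI[of _ L]) auto
        then show ?thesis
          using continuous f \<pi> \<pi>s(1) lim unfolding current_continuous_def by blast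
      qed
      ultimately show ?thesis
        by (simp add: LIMSEQ_const_iff)
    qed
  qed
  with zero_in_metric_1_currents show ?thesis
    by blast
qed

section \<open>Riemann sums\<close>

text \<open>
  The explicit error makes the convergence of the sums below uniform in the integrator, which is what
  the continuity of the current rests on.
\<close>

lemma geometric_Cauchy_limit:
  fixes a :: "nat \<Rightarrow> real"
  assumes step: "\<And>n. \<bar>a (Suc n) - a n\<bar> \<le> D * (1 / 2) ^ Suc n"
  shows "a \<longlonglongrightarrow> lim a" and "\<bar>lim a - a n\<bar> \<le> D * (1 / 2) ^ n"
proof -
  have diff: "\<bar>a (n + k) - a n\<bar> \<le> D * (1 / 2) ^ n - D * (1 / 2) ^ (n + k)" for n k
  proof (induction k)
    case (Suc k)
    moreover have "D * (1 / 2) ^ (n + k) = 2 * (D * (1 / 2) ^ Suc (n + k))"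
      by simp
    ultimately show ?case
      using step[of "n + k"] unfolding add_Suc_right by linarith
  qed simp
  have "0 \<le> D * (1 / 2)"
    using order_trans[OF abs_ge_zero step[of 0]] by simp
  then have "0 \<le> D"
    by simp
  have diff': "\<bar>a m - a n\<bar> \<le> D * (1 / 2) ^ n" if "n \<le> m" for m n
  proof -
    obtain k where k: "m = n + k"
      using le_Suc_ex[OF \<open>n \<le> m\<close>] by blast
    have "0 \<le> D * (1 / 2) ^ (n + k)"
      using \<open>0 \<le> D\<close> by simp
    then show ?thesis
      using diff[of n k] unfolding k by linarith
  qed
  have null: "(\<lambda>n. D * (1 / 2) ^ n) \<longlonglongrightarrow> 0"
    by (intro tendsto_mult_right_zero LIMSEQ_power_zero) simp
  have "Cauchy a"
  proof (rule CauchyI')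
    fix e :: real assume "0 < e"
    obtain N where "D * (1 / 2) ^ N < e"
      using order_tendstoD(2)[OF null \<open>0 < e\<close>] by (auto simp: eventually_sequentially)
    have "dist (a m) (a n) < e" if "N \<le> m" "m < n" for m n
    proof -
      have "D * (1 / 2) ^ m \<le> D * (1 / 2) ^ N"
        using \<open>0 \<le> D\<close> that by (intro mult_left_mono power_decreasing) auto
      with diff'[of m n] that \<open>D * (1 / 2) ^ N < e\<close> show ?thesis
        by (simp add: dist_real_def abs_minus_commute)
    qed
    then show "\<exists>M. \<forall>m\<ge>M. \<forall>n>m. dist (a m) (a n) < e"
      by blast
  qed
  then have "convergent a"
    by (simp add: Cauchy_convergent_iff)
  then show lim: "a \<longlonglongrightarrow> lim a"
    by (simp add: convergent_LIMSEQ_iff)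
  have "(\<lambda>m. \<bar>a m - a n\<bar>) \<longlonglongrightarrow> \<bar>lim a - a n\<bar>"
    by (intro tendsto_intros lim)
  then show "\<bar>lim a - a n\<bar> \<le> D * (1 / 2) ^ n"
    by (rule LIMSEQ_le_const2) (use diff' in blast)
qed

lemma sum_lessThan_double:
  fixes h :: "nat \<Rightarrow> 'b :: comm_monoid_add"
  shows "(\<Sum>i<2 * m. h i) = (\<Sum>i<m. h (2 * i) + h (Suc (2 * i)))"
  by (induction m) (simp_all add: ac_simps)

lemma Riemann_sum_error:
  fixes h :: "real \<Rightarrow> real" and N :: nat
  assumes "0 < N" "0 \<le> K"
    and Lip: "\<And>t u. t \<in> {0..1} \<Longrightarrow> u \<in> {0..1} \<Longrightarrow> \<bar>h t - h u\<bar> \<le> K * \<bar>t - u\<bar>"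
  shows "\<bar>integral {0..1} h - (\<Sum>i<N. h (real i / N)) / N\<bar> \<le> K / N"
proof -
  have cont: "continuous_on {0..1} h"
    by (rule lipschitz_on_continuous_on[of K]) (use assms in \<open>auto simp: lipschitz_on_def dist_real_def\<close>)
  have "\<bar>integral {0..k / N} h - (\<Sum>i<k. h (real i / N)) / N\<bar> \<le> k * (K / N\<^sup>2)" if "k \<le> N" for k :: nat
    using that
  proof (induction k)
    case (Suc k)
    define u v where "u = real k / N" and "v = real (Suc k) / N"
    have uv: "0 \<le> u" "u \<le> v" "v \<le> 1" "v - u = 1 / N"
      using \<open>0 < N\<close> Suc.prems by (auto simp: u_def v_def field_simps)
    have sub: "continuous_on {u..v} h"
      using cont by (rule continuous_on_subset) (use uv in auto)
    have "norm (integral {u..v} (\<lambda>t. h t - h u)) \<le> K / N * (v - u)"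
    proof (rule integral_bound)
      fix t assume t: "t \<in> {u..v}"
      have "\<bar>h t - h u\<bar> \<le> K * \<bar>t - u\<bar>"
        using t uv by (intro Lip) auto
      also have "\<dots> \<le> K * (1 / N)"
        using t uv(4) \<open>0 \<le> K\<close> by (intro mult_left_mono) auto
      finally show "norm (h t - h u) \<le> K / N"
        by simp
    qed (use uv sub in \<open>auto intro!: continuous_intros\<close>)
    moreover have "integral {u..v} (\<lambda>t. h t - h u) = integral {u..v} h - h u / N"
      using uv sub by (subst Henstock_Kurzweil_Integration.integral_diff) (auto intro: integrable_continuous_real)
    moreover have "integral {0..v} h = integral {0..u} h + integral {u..v} h"
    proof -
      have "continuous_on {0..v} h"
        using cont by (rule continuous_on_subset) (use uv in auto)
      then show ?thesis
        using uv by (intro Henstock_Kurzweil_Integration.integral_combine[symmetric] integrable_continuous_real)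
    qed
    moreover have "K / N * (v - u) = K / N\<^sup>2"
      by (simp add: uv(4) power2_eq_square)
    ultimately have "\<bar>integral {0..v} h - (integral {0..u} h + h u / N)\<bar> \<le> K / N\<^sup>2"
      by simp
    moreover have "\<bar>integral {0..u} h - (\<Sum>i<k. h (real i / N)) / N\<bar> \<le> k * (K / N\<^sup>2)"
      using Suc by (simp add: u_def)
    moreover have "(\<Sum>i<Suc k. h (real i / N)) / N = (\<Sum>i<k. h (real i / N)) / N + h u / N"
      by (simp add: u_def add_divide_distrib)
    moreover have "real (Suc k) * (K / N\<^sup>2) = k * (K / N\<^sup>2) + K / N\<^sup>2"
      by (simp add: distrib_right add_divide_distrib)
    ultimately show ?case
      unfolding v_def[symmetric] by linarith
  qed simp
  from this[of N] \<open>0 < N\<close> show ?thesis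
    by (simp add: power2_eq_square)
qed

section \<open>The current of a Lipschitz arc\<close>

locale arc =
  fixes X :: "'a metric" and M :: real and g :: "real \<Rightarrow> 'a"
  assumes arc: "Lipschitz_arc X M g"
begin

lemma M_pos: "0 < M"
  and g_in: "t \<in> {0..1} \<Longrightarrow> g t \<in> mspace X"
  and g_Lip: "t \<in> {0..1} \<Longrightarrow> u \<in> {0..1} \<Longrightarrow> mdist X (g t) (g u) \<le> M * \<bar>t - u\<bar>"
  and g_ends: "g 0 \<noteq> g 1"
  using arc by (auto simp: Lipschitz_arc_def)

lemma along_arc:
  assumes f: "f \<in> Lip X" and t: "t \<in> {0..1}" and u: "u \<in> {0..1}"
  shows "\<bar>f (g t) - f (g u)\<bar> \<le> LIP X f * M * \<bar>t - u\<bar>"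
proof -
  have "\<bar>f (g t) - f (g u)\<bar> \<le> LIP X f * mdist X (g t) (g u)"
    using LIP_bound(2)[OF f] g_in t u by blast
  also have "\<dots> \<le> LIP X f * (M * \<bar>t - u\<bar>)"
    using g_Lip[OF t u] LIP_bound(1)[OF f] by (rule mult_left_mono)
  finally show ?thesis
    by (simp add: mult.assoc)
qed

definition node :: "nat \<Rightarrow> nat \<Rightarrow> 'a" where
  "node n i = g (real i / 2 ^ n)"

lemma node_in: "i \<le> 2 ^ n \<Longrightarrow> node n i \<in> mspace X"
  unfolding node_def by (intro g_in) (simp add: field_simps)

lemma node_refine: "node (Suc n) (2 * i) = node n i"
  by (simp add: node_def)

lemma along_nodes:
  assumes "f \<in> Lip X" "i < 2 ^ n"
  shows "\<bar>f (node n (Suc i)) - f (node n i)\<bar> \<le> LIP X f * M / 2 ^ n"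
proof -
  have "real (Suc i) \<le> 2 ^ n"
    using assms(2) by (metis Suc_leI numeral_power_eq_of_nat_cancel_iff of_nat_le_iff)
  then have "\<bar>f (node n (Suc i)) - f (node n i)\<bar> \<le> LIP X f * M * \<bar>real (Suc i) / 2 ^ n - i / 2 ^ n\<bar>"
    unfolding node_def using assms by (intro along_arc) (auto simp: field_simps)
  also have "\<bar>real (Suc i) / 2 ^ n - i / 2 ^ n\<bar> = 1 / 2 ^ n"
    by (simp add: diff_divide_distrib[symmetric])
  finally show ?thesis
    by simp
qed

definition Stieltjes_sum :: "('a \<Rightarrow> real) \<Rightarrow> ('a \<Rightarrow> real) \<Rightarrow> nat \<Rightarrow> real" where
  "Stieltjes_sum f \<pi> n = (\<Sum>i<(2::nat) ^ n. f (node n i) * (\<pi> (node n (Suc i)) - \<pi> (node n i)))"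

text \<open>
  Inserting the midpoint \<open>m\<close> of a dyadic interval from \<open>u\<close> to \<open>v\<close> changes its term by \<open>(f(m) - f(u)) (\<pi>(v) - \<pi>(m))\<close>,
  which is quadratic in the mesh, while the number of intervals grows only linearly.
\<close>

lemma Stieltjes_sum_refine:
  assumes f: "f \<in> Lip X" and \<pi>: "\<pi> \<in> Lip X"
  shows "\<bar>Stieltjes_sum f \<pi> (Suc n) - Stieltjes_sum f \<pi> n\<bar> \<le> LIP X f * LIP X \<pi> * M\<^sup>2 * (1 / 2) ^ Suc n"
proof -
  let ?m = "\<lambda>i. node (Suc n) (Suc (2 * i))"
  have next_node: "node (Suc n) (Suc (Suc (2 * i))) = node n (Suc i)" for i
    using node_refine[of n "Suc i"] by simp
  have "Stieltjes_sum f \<pi> (Suc n) - Stieltjes_sum f \<pi> n =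
    (\<Sum>i<(2::nat) ^ n. (f (?m i) - f (node n i)) * (\<pi> (node n (Suc i)) - \<pi> (?m i)))"
    unfolding Stieltjes_sum_def power_Suc sum_lessThan_double node_refine next_node
    by (simp add: algebra_simps flip: sum_subtractf)
  also have "\<bar>\<dots>\<bar> \<le> (\<Sum>i<(2::nat) ^ n. LIP X f * M / 2 ^ Suc n * (LIP X \<pi> * M / 2 ^ Suc n))"
  proof (rule order_trans[OF sum_abs sum_mono])
    fix i :: nat assume "i \<in> {..<2 ^ n}"
    then have "\<bar>f (?m i) - f (node n i)\<bar> \<le> LIP X f * M / 2 ^ Suc n"
      "\<bar>\<pi> (node n (Suc i)) - \<pi> (?m i)\<bar> \<le> LIP X \<pi> * M / 2 ^ Suc n"
      using along_nodes[OF f, of "2 * i" "Suc n"] along_nodes[OF \<pi>, of "Suc (2 * i)" "Suc n"]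
      unfolding node_refine next_node by auto
    then show "\<bar>(f (?m i) - f (node n i)) * (\<pi> (node n (Suc i)) - \<pi> (?m i))\<bar>
        \<le> LIP X f * M / 2 ^ Suc n * (LIP X \<pi> * M / 2 ^ Suc n)"
      unfolding abs_mult using LIP_bound(1)[OF f] M_pos by (intro mult_mono) auto
  qed
  also have "\<dots> = LIP X f * LIP X \<pi> * M\<^sup>2 * (1 / 2) ^ Suc n / 2"
    by (simp add: power2_eq_square power_divide)
  also have "\<dots> \<le> LIP X f * LIP X \<pi> * M\<^sup>2 * (1 / 2) ^ Suc n"
    using LIP_bound(1)[OF f] LIP_bound(1)[OF \<pi>] by simp
  finally show ?thesis .
qed

text \<open>
  The Riemann--Stieltjes integral \<open>\<integral> f \<circ> g d(\<pi> \<circ> g)\<close>. As a limit of dyadic sums it requires no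
  differentiability of \<open>\<pi> \<circ> g\<close>.
\<close>

definition arc_current :: "('a \<Rightarrow> real) \<Rightarrow> ('a \<Rightarrow> real) \<Rightarrow> real" where
  "arc_current f \<pi> = (if f \<in> Lip_b X \<and> \<pi> \<in> Lip X then lim (Stieltjes_sum f \<pi>) else 0)"

lemma arc_current_limit:
  assumes "f \<in> Lip_b X" "\<pi> \<in> Lip X"
  shows "Stieltjes_sum f \<pi> \<longlonglongrightarrow> arc_current f \<pi>"
    and "\<bar>arc_current f \<pi> - Stieltjes_sum f \<pi> n\<bar> \<le> LIP X f * LIP X \<pi> * M\<^sup>2 * (1 / 2) ^ n"
proof -
  have "f \<in> Lip X"
    using assms by (simp add: Lip_b_def)
  note lim = geometric_Cauchy_limit[OF Stieltjes_sum_refine[OF this assms(2)]]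
  from lim assms show "Stieltjes_sum f \<pi> \<longlonglongrightarrow> arc_current f \<pi>"
    "\<bar>arc_current f \<pi> - Stieltjes_sum f \<pi> n\<bar> \<le> LIP X f * LIP X \<pi> * M\<^sup>2 * (1 / 2) ^ n"
    by (simp_all add: arc_current_def)
qed

lemma arc_current_eqI:
  assumes "f \<in> Lip_b X" "\<pi> \<in> Lip X" "Stieltjes_sum f \<pi> \<longlonglongrightarrow> r"
  shows "arc_current f \<pi> = r"
  using LIMSEQ_unique[OF arc_current_limit(1)] assms by blast

lemma arc_current_bilinear: "current_bilinear X arc_current"
  unfolding current_bilinear_def
proof (intro conjI ballI allI)
  fix f h \<pi> and a b :: real assume A: "f \<in> Lip_b X" "h \<in> Lip_b X" "\<pi> \<in> Lip X"
  have "Stieltjes_sum (\<lambda>x. a * f x + b * h x) \<pi> = (\<lambda>n. a * Stieltjes_sum f \<pi> n + b * Stieltjes_sum h \<pi> n)"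
    unfolding Stieltjes_sum_def sum_distrib_left sum.distrib[symmetric]
    by (intro ext sum.cong) (auto simp: algebra_simps)
  then have "Stieltjes_sum (\<lambda>x. a * f x + b * h x) \<pi> \<longlonglongrightarrow> a * arc_current f \<pi> + b * arc_current h \<pi>"
    using A by (simp only:) (intro tendsto_add tendsto_mult_left arc_current_limit(1))
  then show "arc_current (\<lambda>x. a * f x + b * h x) \<pi> = a * arc_current f \<pi> + b * arc_current h \<pi>"
    using A by (intro arc_current_eqI Lip_b_linear_combination)
next
  fix f \<pi> \<sigma> and a b :: real assume A: "f \<in> Lip_b X" "\<pi> \<in> Lip X" "\<sigma> \<in> Lip X"
  have "Stieltjes_sum f (\<lambda>x. a * \<pi> x + b * \<sigma> x) = (\<lambda>n. a * Stieltjes_sum f \<pi> n + b * Stieltjes_sum f \<sigma> n)"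
    unfolding Stieltjes_sum_def sum_distrib_left sum.distrib[symmetric]
    by (intro ext sum.cong) (auto simp: algebra_simps)
  then have "Stieltjes_sum f (\<lambda>x. a * \<pi> x + b * \<sigma> x) \<longlonglongrightarrow> a * arc_current f \<pi> + b * arc_current f \<sigma>"
    using A by (simp only:) (intro tendsto_add tendsto_mult_left arc_current_limit(1))
  then show "arc_current f (\<lambda>x. a * \<pi> x + b * \<sigma> x) = a * arc_current f \<pi> + b * arc_current f \<sigma>"
    using A by (intro arc_current_eqI Lip_linear_combination)
qed

text \<open>
  A term survives only if \<open>f\<close> is nonzero at the left node and the right node lies outside \<open>U\<close>. Then \<open>f\<close>
  vanishes at the right node, hence is of the order of the mesh at the left one, and the term is
  quadratic in the mesh.
\<close>

lemma arc_current_local: "current_local X arc_current"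
  unfolding current_local_def
proof (intro ballI allI impI, elim conjE)
  fix f \<pi> U
  assume fb: "f \<in> Lip_b X" and \<pi>: "\<pi> \<in> Lip X" and U: "{x \<in> mspace X. f x \<noteq> 0} \<subseteq> U" "\<pi> constant_on U"
  have f: "f \<in> Lip X"
    using fb by (simp add: Lip_b_def)
  define D where "D = LIP X f * LIP X \<pi> * M\<^sup>2"
  have "\<bar>Stieltjes_sum f \<pi> n\<bar> \<le> D * (1 / 2) ^ n" for n
  proof -
    have "\<bar>Stieltjes_sum f \<pi> n\<bar> \<le> (\<Sum>i<(2::nat) ^ n. LIP X f * M / 2 ^ n * (LIP X \<pi> * M / 2 ^ n))"
      unfolding Stieltjes_sum_def
    proof (rule order_trans[OF sum_abs sum_mono])
      fix i :: nat assume "i \<in> {..<2 ^ n}"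
      then have i: "i < 2 ^ n"
        by simp
      then have in_X: "node n i \<in> mspace X" "node n (Suc i) \<in> mspace X"
        by (auto intro: node_in)
      have nonneg: "0 \<le> LIP X f * M / 2 ^ n * (LIP X \<pi> * M / 2 ^ n)"
        using LIP_bound(1)[OF f] LIP_bound(1)[OF \<pi>] M_pos by simp
      consider "f (node n i) = 0" | "node n i \<in> U" "node n (Suc i) \<in> U" | "f (node n (Suc i)) = 0"
        using U(1) in_X by blast
      then show "\<bar>f (node n i) * (\<pi> (node n (Suc i)) - \<pi> (node n i))\<bar>
        \<le> LIP X f * M / 2 ^ n * (LIP X \<pi> * M / 2 ^ n)"
      proof cases
        case 2
        then have "\<pi> (node n (Suc i)) = \<pi> (node n i)"
          using U(2) by (auto simp: constant_on_def)
        with nonneg show ?thesis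
          by simp
      next
        case 3
        then have "\<bar>f (node n i)\<bar> \<le> LIP X f * M / 2 ^ n"
          using along_nodes[OF f i] by simp
        then show ?thesis
          unfolding abs_mult using along_nodes[OF \<pi> i] LIP_bound(1)[OF f] M_pos
          by (intro mult_mono) auto
      qed (use nonneg in simp)
    qed
    also have "\<dots> = D * (1 / 2) ^ n"
      by (simp add: D_def power2_eq_square power_divide)
    finally show ?thesis .
  qed
  moreover have "(\<lambda>n. D * (1 / 2) ^ n) \<longlonglongrightarrow> 0"
    by (intro tendsto_mult_right_zero LIMSEQ_power_zero) simp
  ultimately have "Stieltjes_sum f \<pi> \<longlonglongrightarrow> 0"
    by (intro Lim_null_comparison[of "Stieltjes_sum f \<pi>" "\<lambda>n. D * (1 / 2) ^ n"]) auto
  then show "arc_current f \<pi> = 0"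
    using fb \<pi> by (intro arc_current_eqI)
qed

text \<open>
  For a fixed partition the sums converge, since they involve finitely many values of \<open>\<pi>\<close>; the error
  of the partition is uniform because the Lipschitz constants are bounded.
\<close>

lemma arc_current_continuous: "current_continuous X arc_current"
  unfolding current_continuous_def
proof (intro ballI allI impI, elim conjE)
  fix f \<pi> and \<pi>s :: "nat \<Rightarrow> 'a \<Rightarrow> real"
  assume fb: "f \<in> Lip_b X" and \<pi>: "\<pi> \<in> Lip X" and \<pi>s: "\<forall>n. \<pi>s n \<in> Lip X"
    and bdd: "bdd_above (range (\<lambda>n. LIP X (\<pi>s n)))"
    and lim: "\<forall>x\<in>mspace X. (\<lambda>n. \<pi>s n x) \<longlonglongrightarrow> \<pi> x"
  have f: "f \<in> Lip X"
    using fb by (simp add: Lip_b_def)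
  obtain B where B: "\<And>n. LIP X (\<pi>s n) \<le> B"
    using bdd by (auto simp: bdd_above_def)
  define D where "D = LIP X f * max B (LIP X \<pi>) * M\<^sup>2"
  have error: "\<bar>arc_current f \<sigma> - Stieltjes_sum f \<sigma> N\<bar> \<le> D * (1 / 2) ^ N"
    if "\<sigma> \<in> Lip X" "LIP X \<sigma> \<le> max B (LIP X \<pi>)" for \<sigma> N
  proof -
    have "LIP X f * LIP X \<sigma> * M\<^sup>2 * (1 / 2) ^ N \<le> D * (1 / 2) ^ N"
      unfolding D_def using that LIP_bound(1)[OF f] by (intro mult_right_mono mult_left_mono) auto
    with arc_current_limit(2)[OF fb that(1), of N] show ?thesis
      by linarith
  qed
  show "(\<lambda>n. arc_current f (\<pi>s n)) \<longlonglongrightarrow> arc_current f \<pi>"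
  proof (rule tendstoI)
    fix e :: real assume "0 < e"
    have "(\<lambda>N. D * (1 / 2) ^ N) \<longlonglongrightarrow> 0"
      by (intro tendsto_mult_right_zero LIMSEQ_power_zero) simp
    then have "\<forall>\<^sub>F N in sequentially. D * (1 / 2) ^ N < e / 3"
      using \<open>0 < e\<close> by (intro order_tendstoD) auto
    then obtain N where N: "D * (1 / 2) ^ N < e / 3"
      by (auto simp: eventually_sequentially)
    have "(\<lambda>n. Stieltjes_sum f (\<pi>s n) N) \<longlonglongrightarrow> Stieltjes_sum f \<pi> N"
      unfolding Stieltjes_sum_def using lim
      by (intro tendsto_sum tendsto_mult tendsto_diff tendsto_const) (auto simp: node_in)
    then have "\<forall>\<^sub>F n in sequentially. \<bar>Stieltjes_sum f (\<pi>s n) N - Stieltjes_sum f \<pi> N\<bar> < e / 3"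
      using \<open>0 < e\<close> tendstoD[of _ _ _ "e / 3"] by (fastforce simp: dist_real_def)
    then show "\<forall>\<^sub>F n in sequentially. dist (arc_current f (\<pi>s n)) (arc_current f \<pi>) < e"
    proof (rule eventually_mono)
      fix n assume "\<bar>Stieltjes_sum f (\<pi>s n) N - Stieltjes_sum f \<pi> N\<bar> < e / 3"
      moreover have "\<bar>arc_current f (\<pi>s n) - Stieltjes_sum f (\<pi>s n) N\<bar> < e / 3"
        using error[of "\<pi>s n" N] \<pi>s B[of n] N by (simp add: le_max_iff_disj)
      moreover have "\<bar>arc_current f \<pi> - Stieltjes_sum f \<pi> N\<bar> < e / 3"
        using error[of \<pi> N] \<pi> N by simp
      ultimately show "dist (arc_current f (\<pi>s n)) (arc_current f \<pi>) < e"
        unfolding dist_real_def by linarith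
    qed
  qed
qed

lemma arc_current_integral_bound:
  assumes fb: "f \<in> Lip_b X" and \<pi>: "\<pi> \<in> Lip X"
  shows "\<bar>arc_current f \<pi>\<bar> \<le> LIP X \<pi> * (M * integral {0..1} (\<lambda>t. \<bar>f (g t)\<bar>))"
proof -
  have f: "f \<in> Lip X"
    using fb by (simp add: Lip_b_def)
  define h where "h t = \<bar>f (g t)\<bar>" for t
  have h: "\<bar>h t - h u\<bar> \<le> LIP X f * M * \<bar>t - u\<bar>" if "t \<in> {0..1}" "u \<in> {0..1}" for t u
    using along_arc[OF f that] by (simp add: h_def)
  define R where "R n = (\<Sum>i<(2::nat) ^ n. h (real i / 2 ^ n)) / 2 ^ n" for n :: nat
  have "\<bar>integral {0..1} h - R n\<bar> \<le> LIP X f * M * (1 / 2) ^ n" for n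
    using Riemann_sum_error[of "2 ^ n" "LIP X f * M" h] h LIP_bound(1)[OF f] M_pos
    by (simp add: R_def power_divide)
  then have bound: "\<bar>R n - integral {0..1} h\<bar> \<le> LIP X f * M * (1 / 2) ^ n" for n
    by (subst abs_minus_commute)
  have null: "(\<lambda>n. LIP X f * M * (1 / 2) ^ n) \<longlonglongrightarrow> 0"
    by (intro tendsto_mult_right_zero LIMSEQ_power_zero) simp
  have "(\<lambda>n. R n - integral {0..1} h) \<longlonglongrightarrow> 0"
    by (rule Lim_null_comparison[OF _ null]) (simp only: real_norm_def bound eventually_True)
  then have "R \<longlonglongrightarrow> integral {0..1} h"
    by (simp add: LIM_zero_iff)
  then have lim_R: "(\<lambda>n. LIP X \<pi> * (M * R n)) \<longlonglongrightarrow> LIP X \<pi> * (M * integral {0..1} h)"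
    by (intro tendsto_mult_left)
  have lim_S: "(\<lambda>n. \<bar>Stieltjes_sum f \<pi> n\<bar>) \<longlonglongrightarrow> \<bar>arc_current f \<pi>\<bar>"
    using arc_current_limit(1)[OF fb \<pi>] by (rule tendsto_rabs)
  have "\<bar>Stieltjes_sum f \<pi> n\<bar> \<le> LIP X \<pi> * (M * R n)" for n
  proof -
    have "\<bar>Stieltjes_sum f \<pi> n\<bar> \<le> (\<Sum>i<(2::nat) ^ n. h (real i / 2 ^ n) * (LIP X \<pi> * M / 2 ^ n))"
      unfolding Stieltjes_sum_def
    proof (rule order_trans[OF sum_abs sum_mono])
      fix i :: nat assume "i \<in> {..<2 ^ n}"
      then show "\<bar>f (node n i) * (\<pi> (node n (Suc i)) - \<pi> (node n i))\<bar> \<le> h (real i / 2 ^ n) * (LIP X \<pi> * M / 2 ^ n)"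
        using along_nodes[OF \<pi>, of i n] unfolding abs_mult h_def node_def by (intro mult_left_mono) auto
    qed
    also have "\<dots> = LIP X \<pi> * (M * R n)"
      unfolding sum_distrib_right[symmetric] R_def by simp
    finally show ?thesis .
  qed
  then have "\<bar>arc_current f \<pi>\<bar> \<le> LIP X \<pi> * (M * integral {0..1} h)"
    by (intro LIMSEQ_le[OF lim_S lim_R] exI[of _ 0] allI impI)
  then show ?thesis
    by (simp add: h_def[abs_def])
qed

text \<open>
  The mass measure is \<open>M\<close> times the image of Lebesgue measure on \<open>{0..1}\<close> under \<open>g\<close>.
\<close>

lemma arc_current_finite_mass: "current_finite_mass X arc_current"
proof -
  define S where "S = sigma (mspace X) {U. openin (mtopology_of X) U}"
  define I where "I = restrict_space lborel {0..1::real}"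
  define \<mu> where "\<mu> = density (distr I S g) (\<lambda>_. ennreal M)"
  have sub: "{U. openin (mtopology_of X) U} \<subseteq> Pow (mspace X)"
    using openin_subset by fastforce
  have S: "space S = mspace X" "sets S = borel_sets_of X"
    using sub by (simp_all add: S_def borel_sets_of_def)
  have I: "space I = {0..1}"
    by (simp add: I_def space_restrict_space)
  have cont: "continuous_map (top_of_set {0..1}) (mtopology_of X) g"
    by (rule Lipschitz_arc_continuous[OF arc])
  have g_measurable: "g \<in> measurable I S"
    unfolding S_def
  proof (rule measurable_measure_of[OF sub])
    show "g \<in> space I \<rightarrow> mspace X"
      using g_in by (auto simp: I)
    fix U assume "U \<in> {U. openin (mtopology_of X) U}"
    then have "openin (top_of_set {0..1}) {t \<in> {0..1}. g t \<in> U}"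
      using openin_continuous_map_preimage[OF cont, of U] by simp
    then obtain V where V: "open V" "{t \<in> {0..1}. g t \<in> U} = {0..1} \<inter> V"
      unfolding openin_open by blast
    have "g -` U \<inter> space I = {t \<in> {0..1}. g t \<in> U}"
      unfolding I by blast
    also have "\<dots> = {0..1} \<inter> V"
      by (rule V(2))
    also have "\<dots> \<in> sets I"
      unfolding I_def sets_restrict_space using V(1) by (intro imageI) simp
    finally show "g -` U \<inter> space I \<in> sets I" .
  qed
  have \<mu>: "space \<mu> = mspace X" "sets \<mu> = borel_sets_of X"
    by (simp_all add: \<mu>_def S)
  have "emeasure \<mu> (space \<mu>) = ennreal M * emeasure I {0..1}"
  proof -
    have "g -` mspace X \<inter> {0..1} = {0..1}"
      using g_in by auto
    moreover have "mspace X \<in> sets S"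
      using sets.top[of S] by (simp add: S)
    ultimately show ?thesis
      using g_measurable by (simp add: \<mu>_def emeasure_density_const emeasure_distr S I)
  qed
  also have "emeasure I {0..1} = 1"
    by (simp add: I_def emeasure_restrict_space)
  finally have fin: "finite_measure \<mu>"
    by (intro finite_measureI) simp
  have integral_\<mu>: "(\<integral>x. \<bar>f x\<bar> \<partial>\<mu>) = M * integral {0..1} (\<lambda>t. \<bar>f (g t)\<bar>)" if fb: "f \<in> Lip_b X" for f
  proof -
    have "f \<in> borel_measurable \<mu>"
      using Lip_b_integrable[OF fb \<mu> fin] by (rule borel_measurable_integrable)
    then have fS: "(\<lambda>x. \<bar>f x\<bar>) \<in> borel_measurable S"
      by (simp add: \<mu>_def)
    have f: "f \<in> Lip X"
      using fb by (simp add: Lip_b_def)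
    have "(LIP X f * M)-lipschitz_on {0..1} (\<lambda>t. f (g t))"
      using along_arc[OF f] LIP_bound(1)[OF f] M_pos by (auto simp: lipschitz_on_def dist_real_def)
    then have cont_f: "continuous_on {0..1} (\<lambda>t. \<bar>f (g t)\<bar>)"
      by (intro continuous_on_rabs lipschitz_on_continuous_on)
    have "(\<integral>x. \<bar>f x\<bar> \<partial>\<mu>) = (\<integral>x. M * \<bar>f x\<bar> \<partial>distr I S g)"
      unfolding \<mu>_def using fS M_pos by (subst integral_density) auto
    also have "\<dots> = M * (\<integral>t. \<bar>f (g t)\<bar> \<partial>I)"
      using fS g_measurable by (simp add: integral_distr)
    also have "(\<integral>t. \<bar>f (g t)\<bar> \<partial>I) = (LINT t:{0..1}|lborel. \<bar>f (g t)\<bar>)"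
      unfolding I_def set_lebesgue_integral_def by (subst integral_restrict_space) auto
    also have "\<dots> = integral {0..1} (\<lambda>t. \<bar>f (g t)\<bar>)"
      by (rule set_borel_integral_eq_integral(2)[OF borel_integrable_atLeastAtMost'[OF cont_f]])
    finally show ?thesis .
  qed
  show ?thesis
    unfolding current_finite_mass_def
    using \<mu> fin arc_current_integral_bound integral_\<mu> by (intro exI[of _ \<mu>]) auto
qed

lemma arc_current_in_metric_1_currents: "arc_current \<in> \<^bold>M\<^sub>1 X"
  unfolding metric_1_currents_def
  using arc_current_bilinear arc_current_local arc_current_continuous arc_current_finite_mass
  by (auto simp: arc_current_def)

text \<open>
  For \<open>f = 1\<close> the sums telescope to \<open>\<pi>(g(1)) - \<pi>(g(0))\<close>, and \<open>\<pi> = d(g(0), _)\<close> separates the end points.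
\<close>

lemma arc_current_nonzero: "\<exists>f \<pi>. arc_current f \<pi> \<noteq> 0"
proof -
  define \<pi> where "\<pi> = mdist X (g 0)"
  have one: "(\<lambda>_. 1) \<in> Lip_b X"
    by (rule Lip_bI[where B = 1], rule LipI(1)[where L = 0]) auto
  have \<pi>: "\<pi> \<in> Lip X"
  proof (rule LipI(1))
    fix x y assume "x \<in> mspace X" "y \<in> mspace X"
    then show "\<bar>\<pi> x - \<pi> y\<bar> \<le> 1 * mdist X x y"
      using mdist_triangle[of "g 0" X x y] mdist_triangle[of "g 0" X y x] g_in[of 0]
      by (simp add: \<pi>_def mdist_commute abs_le_iff)
  qed simp
  have "Stieltjes_sum (\<lambda>_. 1) \<pi> n = mdist X (g 0) (g 1)" for n
    using g_in[of 0] sum_lessThan_telescope[of "\<lambda>i. \<pi> (node n i)" "2 ^ n"]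
    by (simp add: Stieltjes_sum_def node_def \<pi>_def)
  then have "Stieltjes_sum (\<lambda>_. 1) \<pi> = (\<lambda>_. mdist X (g 0) (g 1))"
    by (rule ext)
  then have "Stieltjes_sum (\<lambda>_. 1) \<pi> \<longlonglongrightarrow> mdist X (g 0) (g 1)"
    by (simp only: tendsto_const)
  then have "arc_current (\<lambda>_. 1) \<pi> = mdist X (g 0) (g 1)"
    by (rule arc_current_eqI[OF one \<pi>])
  moreover have "mdist X (g 0) (g 1) \<noteq> 0"
    using g_in[of 0] g_in[of 1] g_ends by simp
  ultimately show ?thesis
    by metis
qed

end

lemma Lipschitz_arc_imp_nonzero_current:
  assumes "Lipschitz_arc X M g"
  shows "\<^bold>M\<^sub>1 X \<noteq> {\<lambda>f \<pi>. 0}"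
proof -
  interpret arc X M g
    by (rule arc.intro) fact
  show ?thesis
    using arc_current_in_metric_1_currents arc_current_nonzero by (metis singletonD)
qed

section \<open>The equivalence\<close>

theorem proposition5p3:
  fixes X :: "'a metric" and \<rho>\<^sub>0 L\<^sub>0 :: real
  assumes "0 < \<rho>\<^sub>0" and "1 \<le> L\<^sub>0"
    and "compact_space (mtopology_of X)"
    and "quasi_selfsimilar L\<^sub>0 \<rho>\<^sub>0 X"
  shows "(biLipschitz_equivalent_to_snowflake X \<longleftrightarrow>
            \<not> (\<exists>\<gamma>. rectifiable_curve X \<gamma> \<and> \<not> \<gamma> constant_on {0..1})) \<and>
         (\<not> (\<exists>\<gamma>. rectifiable_curve X \<gamma> \<and> \<not> \<gamma> constant_on {0..1}) \<longleftrightarrow>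
            \<^bold>M\<^sub>1 X = {\<lambda>f \<pi>. 0})"
proof (cases "\<exists>Y \<alpha> C. snowflake_comparable X Y \<alpha> C")
  case True
  then obtain Y \<alpha> C where cmp: "snowflake_comparable X Y \<alpha> C"
    by blast
  have "biLipschitz_equivalent_to_snowflake X"
    using True by (simp add: biLipschitz_equivalent_to_snowflake_iff)
  moreover have "\<not> (\<exists>\<gamma>. rectifiable_curve X \<gamma> \<and> \<not> \<gamma> constant_on {0..1})"
    using rectifiable_curve_in_snowflake_constant[OF cmp] by blast
  moreover have "\<^bold>M\<^sub>1 X = {\<lambda>f \<pi>. 0}"
    by (rule snowflake_no_currents[OF assms(3) cmp])
  ultimately show ?thesis
    by simp
next
  case False
  then obtain M g where arc: "Lipschitz_arc X M g"
    using no_Lipschitz_arc_imp_fine_chains_long[OF assms] fine_chains_long_imp_snowflake_comparable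
    by metis
  have "\<not> biLipschitz_equivalent_to_snowflake X"
    using False by (simp add: biLipschitz_equivalent_to_snowflake_iff)
  moreover have "\<exists>\<gamma>. rectifiable_curve X \<gamma> \<and> \<not> \<gamma> constant_on {0..1}"
    using Lipschitz_arc_rectifiable[OF arc] by blast
  moreover have "\<^bold>M\<^sub>1 X \<noteq> {\<lambda>f \<pi>. 0}"
    by (rule Lipschitz_arc_imp_nonzero_current[OF arc])
  ultimately show ?thesis
    by simp
qed

end
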